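(* Let $N\ge 1$ be an integer and let $\langle Z_\alpha\rangle$ be a net of nonempty finite multisets in $\mathbf{P}^N_K$. Then $\langle Z_\alpha\rangle$ is $\delta_\gamma$-equidistributed if and only if the limit $$\lim_\alpha\frac{|\{z\in Z_\alpha : \lambda_f(z)<t\}|}{|Z_\alpha|}=0$$ holds for each normalized homogeneous polynomial $f\in K[X]$ and each real number $0<t<1$.
   Context: $K$ is a field complete with respect to a nontrivial non-archimedean absolute value $|\cdot|$; $\mathbb{K}$ is the completion of an algebraic closure of $K$ with respect to the unique extension of $|\cdot|$; $K[X]=K[X_0,\dots,X_N]$. For $f\in K[X]$, $H(f)$ is the maximum absolute value of the coefficients of $f$; $f$ is normalized if $H(f)=1$. Berkovich affine space: $\mathbf{A}^{N+1}_K$ is the set of multiplicative seminorms on $K[X]$ extending $|\cdot|$, i.e. functions $[\cdot]:K[X]\to[0,\infty)$ with $[a]=|a|$ for $a\in K$, $[f+g]\le\max\{[f],[g]\}$ and $[fg]=[f][g]$. The seminorm corresponding to a point $\zeta$ is written $[\cdot]_\zeta$. The topology is the weakest one making $\zeta\mapsto[f]_\zeta$ continuous for every $f\in K[X]$. The point $0$ is the seminorm $f\mapsto|f(0)|$. Put $\|\zeta\|=\max\{[X_0]_\zeta,\dots,[X_N]_\zeta\}$; then $\|\zeta\|=0$ iff $\zeta=0$. Berkovich projective space: $\mathbf{P}^N_K$ is the quotient of $\mathbf{A}^{N+1}_K\setminus\{0\}$, with the quotient topology, by the equivalence relation: $\zeta\sim\xi$ iff there is a constant $\lambda>0$ with $[f]_\zeta=\lambda^{\deg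 f}[f]_\xi$ for all homogeneous $f\in K[X]$. Let $\pi$ be the quotient map. For homogeneous $f\in K[X]$, the function $\lambda_f:\mathbf{P}^N_K\to\mathbb{R}$ is defined by $\lambda_f(\pi(\zeta))=[f]_\zeta/\|\zeta\|^{\deg f}$ (well defined on equivalence classes). Gauss point: $\zeta_{0,1}\in\mathbf{A}^{N+1}_K$ is given by $[f]_{\zeta_{0,1}}=\sup\{|f(b)|: b\in\mathbb{K}^{N+1},\ |b_n|\le 1\text{ for all }0\le n\le N\}$; $\gamma=\pi(\zeta_{0,1})$, and $\delta_\gamma$ is the unit Dirac measure at $\gamma$. Equidistribution: for a unit Borel measure $\mu$ on $\mathbf{P}^N_K$, a net $\langle Z_\alpha\rangle$ of nonempty finite multisets in $\mathbf{P}^N_K$ is $\mu$-equidistributed if $\frac{1}{|Z_\alpha|}\sum_{z\in Z_\alpha}\varphi(z)\to\int\varphi\,d\mu$ for every continuous $\varphi:\mathbf{P}^N_K\to\mathbb{R}$. A multiset is a set whose points occur with multiplicities; all cardinalities and sums are counted with multiplicity. *)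

theory Defs
  imports
    "HOL-Probability.Probability"
    "HOL-Algebra.Algebraic_Closure_Type"
    "HOL-Library.Poly_Mapping"
    "HOL-Library.Multiset"
begin

section \<open>Valued fields\<close>

locale nonarch_abs =
  fixes v :: "'a::field \<Rightarrow> real"
  assumes nonneg: "0 \<le> v x"
    and eq_0_iff: "v x = 0 \<longleftrightarrow> x = 0"
    and mult: "v (x * y) = v x * v y"
    and ultra: "v (x + y) \<le> max (v x) (v y)"
begin

lemma zero [simp]: "v 0 = 0"
  by (simp add: eq_0_iff)

lemma one [simp]: "v 1 = 1"
proof -
  have "v 1 * v 1 = v 1 * 1" using mult[of 1 1] by simp
  moreover have "v 1 \<noteq> 0" by (simp add: eq_0_iff)
  ultimately show ?thesis by (metis mult_cancel_left)
qed

lemma minus [simp]: "v (- x) = v x"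
proof -
  have "v (-1) ^ 2 = 1 ^ 2" using mult[of "-1" "-1"] by (simp add: power2_eq_square)
  then have "v (-1) = 1" by (rule power2_eq_imp_eq) (simp_all add: nonneg)
  then show ?thesis using mult[of "-1" x] by simp
qed

end

definition abs_dist :: "('a::field \<Rightarrow> real) \<Rightarrow> 'a \<Rightarrow> 'a \<Rightarrow> real" where
  "abs_dist v x y = v (x - y)"

lemma (in nonarch_abs) Metric_space_abs_dist: "Metric_space UNIV (abs_dist v)"
proof
  fix x y z :: 'a
  show "0 \<le> abs_dist v x y" by (simp add: abs_dist_def nonneg)
  show "abs_dist v x y = abs_dist v y x" unfolding abs_dist_def by (metis minus minus_diff_eq)
  show "abs_dist v x y = 0 \<longleftrightarrow> x = y" by (simp add: abs_dist_def eq_0_iff)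
  have "v ((x - y) + (y - z)) \<le> max (v (x - y)) (v (y - z))" by (rule ultra)
  then have "v (x - z) \<le> max (v (x - y)) (v (y - z))" by simp
  then show "abs_dist v x z \<le> abs_dist v x y + abs_dist v y z"
    using nonneg[of "x - y"] nonneg[of "y - z"] unfolding abs_dist_def by linarith
qed

definition complete_abs :: "('a::field \<Rightarrow> real) \<Rightarrow> bool" where
  "complete_abs v \<longleftrightarrow> Metric_space.mcomplete UNIV (abs_dist v)"

definition nontrivial_abs :: "('a::field \<Rightarrow> real) \<Rightarrow> bool" where
  "nontrivial_abs v \<longleftrightarrow> (\<exists>x. x \<noteq> 0 \<and> v x \<noteq> 1)"

text \<open>The valued field \<open>(k, u)\<close>, together with the map \<open>j\<close>, is a completion of the valued
  field \<open>(l, w)\<close>.\<close>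

definition is_completion ::
    "('l::field \<Rightarrow> real) \<Rightarrow> ('k::field \<Rightarrow> real) \<Rightarrow> ('l \<Rightarrow> 'k) \<Rightarrow> bool" where
  "is_completion w u j \<longleftrightarrow>
     nonarch_abs u \<and> complete_abs u \<and>
     j 0 = 0 \<and> j 1 = 1 \<and> (\<forall>x y. j (x + y) = j x + j y) \<and> (\<forall>x y. j (x * y) = j x * j y) \<and>
     (\<forall>x. u (j x) = w x) \<and>
     Metric_space.mtopology UNIV (abs_dist u) closure_of (range j) = UNIV"


section \<open>Polynomials\<close>

text \<open>The polynomial ring over \<open>'a\<close> in variables indexed by the finite type \<open>'n\<close>.\<close>

type_synonym ('n, 'a) mpoly = "('n \<Rightarrow>\<^sub>0 nat) \<Rightarrow>\<^sub>0 'a"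

definition Const :: "'a::zero \<Rightarrow> ('n, 'a) mpoly" where
  "Const a = Poly_Mapping.single 0 a"

definition Var :: "'n \<Rightarrow> ('n, 'a::zero_neq_one) mpoly" where
  "Var i = Poly_Mapping.single (Poly_Mapping.single i 1) 1"

definition mono_deg :: "('n::finite \<Rightarrow>\<^sub>0 nat) \<Rightarrow> nat" where
  "mono_deg m = (\<Sum>i\<in>UNIV. Poly_Mapping.lookup m i)"

text \<open>The zero polynomial gets degree 0; it is homogeneous.\<close>

definition total_deg :: "('n::finite, 'a::zero) mpoly \<Rightarrow> nat" where
  "total_deg f = Max (insert 0 (mono_deg ` Poly_Mapping.keys f))"

definition homogeneous :: "('n::finite, 'a::zero) mpoly \<Rightarrow> bool" where
  "homogeneous f \<longleftrightarrow> (\<exists>d. \<forall>m\<in>Poly_Mapping.keys f. mono_deg m = d)"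

text \<open>Evaluation at \<open>b\<close> in an extension of the coefficient ring, along the embedding \<open>h\<close>.\<close>

definition poly_eval ::
    "('a::zero \<Rightarrow> 'b::comm_ring_1) \<Rightarrow> ('n::finite, 'a) mpoly \<Rightarrow> ('n \<Rightarrow> 'b) \<Rightarrow> 'b" where
  "poly_eval h f b =
     (\<Sum>m\<in>Poly_Mapping.keys f. h (Poly_Mapping.lookup f m) *
        (\<Prod>i\<in>UNIV. b i ^ Poly_Mapping.lookup m i))"

text \<open>The maximum is over all monomials, but only finitely many coefficients are nonzero,
  so the set of values is finite.\<close>

definition height :: "('a::zero \<Rightarrow> real) \<Rightarrow> ('n, 'a) mpoly \<Rightarrow> real" where
  "height v f = Max (range (\<lambda>m. v (Poly_Mapping.lookup f m)))"

definition normalized :: "('a::zero \<Rightarrow> real) \<Rightarrow> ('n, 'a) mpoly \<Rightarrow> bool" where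
  "normalized v f \<longleftrightarrow> height v f = 1"

lemma finite_height_set: "finite (range (\<lambda>m. v (Poly_Mapping.lookup f m)))"
proof -
  have "range (\<lambda>m. v (Poly_Mapping.lookup f m))
      \<subseteq> insert (v 0) ((\<lambda>m. v (Poly_Mapping.lookup f m)) ` Poly_Mapping.keys f)"
  proof
    fix x assume "x \<in> range (\<lambda>m. v (Poly_Mapping.lookup f m))"
    then obtain m where x: "x = v (Poly_Mapping.lookup f m)" by blast
    show "x \<in> insert (v 0) ((\<lambda>m. v (Poly_Mapping.lookup f m)) ` Poly_Mapping.keys f)"
      by (cases "m \<in> Poly_Mapping.keys f") (simp_all add: x in_keys_iff)
  qed
  then show ?thesis by (rule finite_subset) simp
qed

lemma homogeneous_iff:
  "homogeneous f \<longleftrightarrow> (\<forall>m\<in>Poly_Mapping.keys f. mono_deg m = total_deg f)"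
proof
  assume "homogeneous f"
  then obtain d where d: "\<forall>m\<in>Poly_Mapping.keys f. mono_deg m = d"
    by (auto simp: homogeneous_def)
  show "\<forall>m\<in>Poly_Mapping.keys f. mono_deg m = total_deg f"
  proof
    fix m assume m: "m \<in> Poly_Mapping.keys f"
    then have "mono_deg ` Poly_Mapping.keys f = {d}" using d by auto
    then show "mono_deg m = total_deg f" using d m by (simp add: total_deg_def)
  qed
qed (auto simp: homogeneous_def)

lemma homogeneous_Var: "homogeneous (Var i :: ('n::finite, 'a::zero_neq_one) mpoly)"
  by (auto simp: homogeneous_def Var_def)

lemma total_deg_Var: "total_deg (Var i :: ('n::finite, 'a::zero_neq_one) mpoly) = 1"
  by (simp add: total_deg_def Var_def mono_deg_def lookup_single when_def)


section \<open>Berkovich affine space\<close>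

type_synonym ('n, 'a) seminorm = "('n, 'a) mpoly \<Rightarrow> real"

definition aff_space :: "('a::field \<Rightarrow> real) \<Rightarrow> ('n::finite, 'a) seminorm set" where
  "aff_space v = {z. (\<forall>f. 0 \<le> z f) \<and> (\<forall>a. z (Const a) = v a) \<and>
     (\<forall>f g. z (f + g) \<le> max (z f) (z g)) \<and> (\<forall>f g. z (f * g) = z f * z g)}"

text \<open>The weakest topology on \<open>aff_space v\<close> for which all evaluations are continuous.\<close>

definition aff_topology :: "('a::field \<Rightarrow> real) \<Rightarrow> ('n::finite, 'a) seminorm topology" where
  "aff_topology v = topology_generated_by {{z \<in> aff_space v. z f \<in> U} | f U. open U}"

lemma topspace_aff_topology [simp]: "topspace (aff_topology v) = aff_space v"
proof -
  let ?S = "{{z \<in> aff_space v. z f \<in> U} | f U. open U}"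
  have "\<Union> ?S = aff_space v"
  proof (rule antisym)
    show "\<Union> ?S \<subseteq> aff_space v"
    proof (rule Union_least)
      fix B assume "B \<in> ?S"
      then obtain f U where "B = {z \<in> aff_space v. z f \<in> U}" by (elim CollectE exE conjE)
      then show "B \<subseteq> aff_space v" by simp
    qed
    have "\<exists>f U. aff_space v = {z \<in> aff_space v. z f \<in> U} \<and> open U"
      by (intro exI[of _ 0] exI[of _ UNIV]) simp
    then show "aff_space v \<subseteq> \<Union> ?S"
      by (intro Union_upper) (rule CollectI)
  qed
  then show ?thesis
    unfolding aff_topology_def by (simp only: topology_generated_by_topspace)
qed

definition aff_zero :: "('a::field \<Rightarrow> real) \<Rightarrow> ('n::finite, 'a) seminorm" where
  "aff_zero v f = v (poly_eval (\<lambda>a. a) f (\<lambda>_. 0))"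

definition pnorm :: "('n::finite, 'a::field) seminorm \<Rightarrow> real" where
  "pnorm z = Max (range (\<lambda>i. z (Var i)))"


section \<open>Berkovich projective space\<close>

definition punctured :: "('a::field \<Rightarrow> real) \<Rightarrow> ('n::finite, 'a) seminorm set" where
  "punctured v = aff_space v - {aff_zero v}"

definition proj_rel :: "('a::field \<Rightarrow> real) \<Rightarrow> ('n::finite, 'a) seminorm rel" where
  "proj_rel v = {(z, w). z \<in> punctured v \<and> w \<in> punctured v \<and>
     (\<exists>c>0. \<forall>f. homogeneous f \<longrightarrow> z f = c ^ total_deg f * w f)}"

definition proj :: "('a::field \<Rightarrow> real) \<Rightarrow> ('n::finite, 'a) seminorm \<Rightarrow> ('n, 'a) seminorm set" where
  "proj v z = proj_rel v `` {z}"

definition proj_space :: "('a::field \<Rightarrow> real) \<Rightarrow> ('n::finite, 'a) seminorm set set" where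
  "proj_space v = punctured v // proj_rel v"

definition proj_topology :: "('a::field \<Rightarrow> real) \<Rightarrow> ('n::finite, 'a) seminorm set topology" where
  "proj_topology v = topology (\<lambda>U. U \<subseteq> proj_space v \<and>
     openin (subtopology (aff_topology v) (punctured v)) {z \<in> punctured v. proj v z \<in> U})"

lemma equiv_proj_rel: "equiv (punctured v) (proj_rel v)"
proof (rule equivI)
  show "refl_on (punctured v) (proj_rel v)"
    unfolding refl_on_def proj_rel_def by (auto intro: exI[of _ "1::real"])
  show "proj_rel v \<subseteq> punctured v \<times> punctured v"
    by (auto simp: proj_rel_def)
  show "sym (proj_rel v)"
  proof (rule symI)
    fix z w assume "(z, w) \<in> proj_rel v"
    then obtain c where zw: "z \<in> punctured v" "w \<in> punctured v" and c: "c > 0"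
      "\<And>f. homogeneous f \<Longrightarrow> z f = c ^ total_deg f * w f"
      by (auto simp: proj_rel_def)
    have "w f = (1 / c) ^ total_deg f * z f" if "homogeneous f" for f
      using c(1) c(2)[OF that] by (simp add: field_simps power_one_over)
    then show "(w, z) \<in> proj_rel v"
      using zw c(1) unfolding proj_rel_def by (auto intro: exI[of _ "1 / c"])
  qed
  show "trans (proj_rel v)"
  proof (rule transI)
    fix x y z assume "(x, y) \<in> proj_rel v" "(y, z) \<in> proj_rel v"
    then obtain c d where "x \<in> punctured v" "z \<in> punctured v" and c: "c > 0" "d > 0"
      "\<And>f. homogeneous f \<Longrightarrow> x f = c ^ total_deg f * y f"
      "\<And>f. homogeneous f \<Longrightarrow> y f = d ^ total_deg f * z f"
      by (auto simp: proj_rel_def)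
    moreover have "x f = (c * d) ^ total_deg f * z f" if "homogeneous f" for f
      using c(3,4)[OF that] by (simp add: power_mult_distrib)
    moreover have "0 < c * d" using c(1,2) by simp
    ultimately show "(x, z) \<in> proj_rel v"
      unfolding proj_rel_def by blast
  qed
qed

lemma proj_in_space: "z \<in> punctured v \<Longrightarrow> proj v z \<in> proj_space v"
  by (simp add: proj_def proj_space_def quotientI)

lemma openin_proj_topology:
  fixes v :: "'a::field \<Rightarrow> real" and U :: "('n::finite, 'a) seminorm set set"
  shows "openin (proj_topology v) U \<longleftrightarrow> U \<subseteq> proj_space v \<and>
     openin (subtopology (aff_topology v) (punctured v)) {z \<in> punctured v. proj v z \<in> U}"
proof -
  let ?T = "subtopology (aff_topology v) (punctured v) :: ('n, 'a) seminorm topology"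
  let ?P = "\<lambda>U :: ('n, 'a) seminorm set set. U \<subseteq> proj_space v \<and> openin ?T {z \<in> punctured v. proj v z \<in> U}"
  have "istopology ?P"
    unfolding istopology_def
  proof (rule conjI; intro allI impI)
    fix A B assume A: "?P A" and B: "?P B"
    have "{z \<in> punctured v. proj v z \<in> A \<inter> B} =
        {z \<in> punctured v. proj v z \<in> A} \<inter> {z \<in> punctured v. proj v z \<in> B}"
      by auto
    also have "openin ?T \<dots>"
      using A B by (intro openin_Int) (rule conjunct2; assumption)+
    finally show "?P (A \<inter> B)"
      using A by (simp add: le_infI1)
  next
    fix \<K> assume K: "\<forall>B\<in>\<K>. ?P B"
    have "{z \<in> punctured v. proj v z \<in> \<Union>\<K>} =
        \<Union> ((\<lambda>B. {z \<in> punctured v. proj v z \<in> B}) ` \<K>)"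
      by auto
    also have "openin ?T \<dots>"
    proof (rule openin_Union)
      fix B assume "B \<in> (\<lambda>B. {z \<in> punctured v. proj v z \<in> B}) ` \<K>"
      then show "openin ?T B" using K by (elim imageE) simp
    qed
    finally show "?P (\<Union>\<K>)"
      using K by (simp add: Union_least)
  qed
  then show ?thesis
    unfolding proj_topology_def by (simp only: topology_inverse')
qed

lemma topspace_punctured:
  "topspace (subtopology (aff_topology v) (punctured v)) = punctured v"
  by (auto simp: punctured_def)

lemma topspace_proj_topology [simp]:
  fixes v :: "'a::field \<Rightarrow> real"
  shows "topspace (proj_topology v) = (proj_space v :: ('n::finite, 'a) seminorm set set)"
proof (rule antisym)
  show "topspace (proj_topology v) \<subseteq> (proj_space v :: ('n, 'a) seminorm set set)"
    by (meson openin_proj_topology openin_topspace)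
  let ?T = "subtopology (aff_topology v) (punctured v) :: ('n, 'a) seminorm topology"
  have "{z \<in> punctured v. proj v z \<in> proj_space v} = topspace ?T"
    unfolding topspace_punctured by (auto intro: proj_in_space)
  then have "openin ?T {z \<in> punctured v. proj v z \<in> proj_space v}"
    by (simp only: openin_topspace)
  then have "openin (proj_topology v) (proj_space v :: ('n, 'a) seminorm set set)"
    by (simp add: openin_proj_topology)
  then show "(proj_space v :: ('n, 'a) seminorm set set) \<subseteq> topspace (proj_topology v)" by (rule openin_subset)
qed

lemma quotient_map_proj:
  "quotient_map (subtopology (aff_topology v) (punctured v)) (proj_topology v) (proj v)"
proof -
  have "proj v ` punctured v = proj_space v"
    by (auto simp: proj_space_def quotient_def proj_def)
  then show ?thesis
    unfolding quotient_map_def openin_proj_topology topspace_punctured topspace_proj_topology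
    by blast
qed

text \<open>The value does not depend on the representative, see \<open>lam_proj\<close> below.\<close>

definition lam :: "('n::finite, 'a::field) mpoly \<Rightarrow> ('n, 'a) seminorm set \<Rightarrow> real" where
  "lam f p = (let z = (SOME z. z \<in> p) in z f / pnorm z ^ total_deg f)"

lemma lam_proj:
  assumes "homogeneous f" "z \<in> punctured v"
  shows "lam f (proj v z) = z f / pnorm z ^ total_deg f"
proof -
  define w where "w = (SOME w. w \<in> proj v z)"
  have "z \<in> proj v z"
    using equiv_class_self[OF equiv_proj_rel assms(2)] by (simp add: proj_def)
  then have "w \<in> proj v z" unfolding w_def by (rule someI[of "\<lambda>w. w \<in> proj v z"])
  then obtain c where c: "c > 0" "\<And>g. homogeneous g \<Longrightarrow> z g = c ^ total_deg g * w g"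
    by (auto simp: proj_def proj_rel_def)
  have "range (\<lambda>i. z (Var i)) = (*) c ` range (\<lambda>i. w (Var i))"
    using c(2)[OF homogeneous_Var] by (simp add: total_deg_Var image_image)
  moreover have "mono ((*) c)" using c(1) by (intro monoI) simp
  ultimately have "pnorm z = c * pnorm w"
    unfolding pnorm_def by (simp add: mono_Max_commute)
  then have "z f / pnorm z ^ total_deg f = w f / pnorm w ^ total_deg f"
    using c(1) c(2)[OF assms(1)] by (simp add: power_mult_distrib)
  then show ?thesis by (simp add: lam_def w_def Let_def)
qed

text \<open>The Gauss point; \<open>h\<close> is the embedding of the ground field into the field with absolute
  value \<open>u\<close>.\<close>

definition gauss_aff ::
    "('k::field \<Rightarrow> real) \<Rightarrow> ('a::field \<Rightarrow> 'k) \<Rightarrow> ('n::finite, 'a) seminorm" where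
  "gauss_aff u h f = (SUP b\<in>{b. \<forall>i. u (b i) \<le> 1}. u (poly_eval h f b))"


section \<open>Equidistribution\<close>

definition borel_of :: "'p topology \<Rightarrow> 'p measure" where
  "borel_of T = sigma (topspace T) {U. openin T U}"

definition directed_set :: "'i set \<Rightarrow> ('i \<Rightarrow> 'i \<Rightarrow> bool) \<Rightarrow> bool" where
  "directed_set A r \<longleftrightarrow> A \<noteq> {} \<and> reflp_on A r \<and> transp_on A r \<and>
     (\<forall>a\<in>A. \<forall>b\<in>A. \<exists>c\<in>A. r a c \<and> r b c)"

text \<open>Convergence of a net indexed by the directed set \<open>A\<close> is convergence along the filter
  generated by the tails of \<open>A\<close>.\<close>

definition net_filter :: "'i set \<Rightarrow> ('i \<Rightarrow> 'i \<Rightarrow> bool) \<Rightarrow> 'i filter" where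
  "net_filter A r = (INF a\<in>A. principal {b \<in> A. r a b})"

lemma eventually_net_filter:
  assumes "directed_set A r"
  shows "eventually P (net_filter A r) \<longleftrightarrow> (\<exists>a\<in>A. \<forall>b\<in>A. r a b \<longrightarrow> P b)"
proof -
  have "eventually P (net_filter A r) \<longleftrightarrow> (\<exists>a\<in>A. eventually P (principal {b \<in> A. r a b}))"
    unfolding net_filter_def
  proof (rule eventually_INF_base)
    show "A \<noteq> {}" using assms by (simp add: directed_set_def)
    fix a b assume ab: "a \<in> A" "b \<in> A"
    then obtain c where c: "c \<in> A" "r a c" "r b c"
      using assms by (auto simp: directed_set_def)
    have "{d \<in> A. r c d} \<subseteq> {d \<in> A. r a d} \<inter> {d \<in> A. r b d}"
      using assms ab c by (auto simp: directed_set_def dest: transp_onD)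
    then show "\<exists>x\<in>A. principal {b \<in> A. r x b} \<le>
        inf (principal {b \<in> A. r a b}) (principal {d \<in> A. r b d})"
      using c(1) by (intro bexI[of _ c]) simp_all
  qed
  then show ?thesis by (auto simp: eventually_principal)
qed

definition equidistributed ::
    "'p topology \<Rightarrow> 'p measure \<Rightarrow> 'i filter \<Rightarrow> ('i \<Rightarrow> 'p multiset) \<Rightarrow> bool" where
  "equidistributed T \<mu> F Z \<longleftrightarrow>
     (\<forall>\<phi>. continuous_map T euclideanreal \<phi> \<longrightarrow>
       ((\<lambda>\<alpha>. (\<Sum>z\<in>#Z \<alpha>. \<phi> z) / real (size (Z \<alpha>))) \<longlongrightarrow> (\<integral>z. \<phi> z \<partial>\<mu>)) F)"

end

theory Submission
  imports Defs
begin

text \<open>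
  The Gauss norm of a polynomial is its height \<open>H\<close>, the largest absolute value of its
  coefficients. Therefore \<open>\<lambda>\<^sub>f(\<gamma>) = 1\<close> for every normalized homogeneous \<open>f\<close>. At every point of
  projective space the ultrametric inequality gives \<open>\<lambda>\<^sub>f \<le> 1\<close>, and a point at which \<open>\<lambda>\<^sub>f = 1\<close> for all
  normalized homogeneous \<open>f\<close> is \<open>\<gamma>\<close> itself (\<open>eq_gauss_of_lam_ge_1\<close>). So the open sets \<open>{\<lambda>\<^sub>f < t}\<close> with
  \<open>0 < t < 1\<close> cover exactly the complement of \<open>\<gamma>\<close>. Since projective space is compact
  (\<open>compact_space_proj\<close>), the complement of any open neighbourhood of \<open>\<gamma>\<close> is covered by finitely many
  of them, and the condition on the sets \<open>{\<lambda>\<^sub>f < t}\<close> says that asymptotically all the mass is near \<open>\<gamma>\<close>.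
  This last step is a fact about Dirac measures on compact spaces (\<open>equidistributed_return_iff\<close>).

  Two ingredients need work. That the Gauss norm equals the height, and that it is multiplicative
  (\<open>gauss_eq_height\<close>, \<open>height_mult\<close>), is seen at the points with coordinates \<open>T ^ e i\<close>, where \<open>|T|\<close>
  tends to 1 from below and the exponents \<open>e i\<close> separate the finitely many monomials involved. There
  the nonzero terms of a polynomial eventually have pairwise distinct absolute values, and its absolute
  value is that of its largest term. Such \<open>T\<close> exist because roots of any order can be extracted.
  Compactness follows from Tychonoff's theorem: rescaling by elements of the ground field, whose
  absolute value is nontrivial, moves a representative of each class into the annulus
  \<open>1 \<le> \<parallel>z\<parallel> \<le> R\<close> for a fixed \<open>R\<close>, and this annulus is compact.
\<close>

section \<open>Ultrametric sums\<close>

lemma ultrametric_sum_le: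
  fixes \<nu> :: "'x::comm_monoid_add \<Rightarrow> real"
  assumes "\<And>x y. \<nu> (x + y) \<le> max (\<nu> x) (\<nu> y)" "\<nu> 0 = 0" "0 \<le> C" "\<And>s. s \<in> S \<Longrightarrow> \<nu> (t s) \<le> C"
  shows "\<nu> (sum t S) \<le> C"
  using assms(4)
proof (induction S rule: infinite_finite_induct)
  case (insert s S)
  then have "\<nu> (t s) \<le> C" "\<nu> (sum t S) \<le> C" by auto
  then show ?case using insert.hyps assms(1)[of "t s" "sum t S"] by simp
qed (use assms in auto)

text \<open>With pairwise distinct absolute values no cancellation is possible: the term of largest
  absolute value strictly dominates the sum of all the others.\<close>

lemma (in nonarch_abs) le_sum_of_distinct_abs:
  assumes "finite S" "inj_on (\<lambda>s. v (t s)) S" "\<And>s. s \<in> S \<Longrightarrow> t s \<noteq> 0" "s \<in> S"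
  shows "v (t s) \<le> v (sum t S)"
proof -
  let ?M = "Max ((\<lambda>s. v (t s)) ` S)"
  have "?M \<in> (\<lambda>s. v (t s)) ` S" using assms(1,4) by (intro Max_in) auto
  then obtain q where q: "q \<in> S" "?M = v (t q)" by blast
  have le: "v (t p) \<le> v (t q)" if "p \<in> S" for p
    using that assms(1) q(2) by (metis Max_ge finite_imageI imageI)
  have lt: "v (t p) < v (t q)" if "p \<in> S - {q}" for p
    using that le[of p] assms(2) q(1) by (force simp: inj_on_def less_le)
  have small: "v (sum t (S - {q})) < v (t q)"
  proof (cases "S - {q} = {}")
    case True
    then have "sum t (S - {q}) = 0" by (simp only: sum.empty)
    then show ?thesis using assms(3)[OF q(1)] eq_0_iff nonneg[of "t q"] by (auto simp: less_le)
  next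
    case False
    let ?C = "Max ((\<lambda>s. v (t s)) ` (S - {q}))"
    have "?C \<in> (\<lambda>s. v (t s)) ` (S - {q})" using False assms(1) by (intro Max_in) auto
    then obtain p where "p \<in> S - {q}" "?C = v (t p)" by blast
    then have "?C < v (t q)" "0 \<le> ?C" using lt[of p] nonneg[of "t p"] by auto
    moreover have "v (sum t (S - {q})) \<le> ?C"
      using assms(1) \<open>0 \<le> ?C\<close> by (intro ultrametric_sum_le[where \<nu> = v, OF ultra zero]) auto
    ultimately show ?thesis by linarith
  qed
  have "t q = sum t S + - sum t (S - {q})"
    using assms(1) q(1) by (simp add: sum.remove)
  then have "v (t q) \<le> max (v (sum t S)) (v (sum t (S - {q})))"
    by (metis ultra minus)
  then have "v (t q) \<le> v (sum t S)" using small by linarith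
  then show ?thesis using le[OF assms(4)] by linarith
qed

lemma (in nonarch_abs) abs_pow: "v (x ^ n) = v x ^ n"
  by (induction n) (simp_all add: mult)

lemma (in nonarch_abs) abs_inverse: "v (inverse x) = inverse (v x)"
proof (cases "x = 0")
  case False
  then have "v x * v (inverse x) = 1" using mult[of x "inverse x"] by simp
  then show ?thesis by (simp add: inverse_unique)
qed simp

lemma (in nonarch_abs) exists_abs_gt_1:
  assumes "nontrivial_abs v"
  obtains c where "1 < v c"
proof -
  obtain x where x: "x \<noteq> 0" "v x \<noteq> 1" using assms by (auto simp: nontrivial_abs_def)
  then have "0 < v x" using nonneg[of x] eq_0_iff[of x] by linarith
  then have "1 < v x \<or> 1 < v (inverse x)"
    using x(2) by (auto simp: abs_inverse one_less_inverse_iff)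
  then show ?thesis using that by blast
qed


section \<open>Monomials and evaluation\<close>

definition mono_val :: "('n::finite \<Rightarrow> 'b::comm_monoid_mult) \<Rightarrow> ('n \<Rightarrow>\<^sub>0 nat) \<Rightarrow> 'b" where
  "mono_val b m = (\<Prod>i\<in>UNIV. b i ^ Poly_Mapping.lookup m i)"

lemma mono_val_add: "mono_val b (m + n) = mono_val b m * mono_val b n"
  by (simp add: mono_val_def lookup_add power_add prod.distrib)

lemma mono_val_0 [simp]: "mono_val b 0 = 1"
  by (simp add: mono_val_def)

lemma mono_val_single: "mono_val b (Poly_Mapping.single i k) = b i ^ k"
proof -
  have "b l ^ Poly_Mapping.lookup (Poly_Mapping.single i k) l = (if l = i then b i ^ k else 1)" for l
    by (simp add: lookup_single when_def)
  then show ?thesis by (simp add: mono_val_def)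
qed

lemma mono_val_const: "mono_val (\<lambda>_. c) m = c ^ mono_deg m"
  by (simp add: mono_val_def mono_deg_def power_sum)

lemma mono_val_scale: "mono_val (\<lambda>i. c * b i) m = c ^ mono_deg m * mono_val b m"
  by (simp add: mono_val_def mono_deg_def power_sum power_mult_distrib prod.distrib)

lemma mono_val_at_0:
  "mono_val (\<lambda>_. 0 :: 'b::idom) m = (if m = 0 then 1 else 0)"
proof (cases "m = 0")
  case False
  then obtain i where "Poly_Mapping.lookup m i \<noteq> 0" by (metis lookup_zero poly_mapping_eqI)
  then have "mono_val (\<lambda>_. 0 :: 'b) m = 0" unfolding mono_val_def by (intro prod_zero) (auto intro!: exI[of _ i])
  then show ?thesis using False by simp
qed simp

lemma mono_val_Var: "mono_val Var m = Poly_Mapping.single m (1 :: 'a::comm_ring_1)"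
proof -
  have pow: "Var i ^ k = Poly_Mapping.single (Poly_Mapping.single i k) (1 :: 'a)" for i :: 'n and k
    by (induction k) (simp_all add: Var_def mult_single flip: single_add)
  have "(\<Prod>i\<in>I. Var i ^ Poly_Mapping.lookup m i) =
      Poly_Mapping.single (\<Sum>i\<in>I. Poly_Mapping.single i (Poly_Mapping.lookup m i)) (1 :: 'a)" for I
    by (induction I rule: infinite_finite_induct) (simp_all add: pow mult_single)
  moreover have "(\<Sum>i\<in>UNIV. Poly_Mapping.single i (Poly_Mapping.lookup m i)) = m"
    by (rule poly_mapping_eqI) (simp add: lookup_sum lookup_single when_def)
  ultimately show ?thesis by (simp add: mono_val_def)
qed

lemma poly_eval_eq: "poly_eval h f b = (\<Sum>m\<in>Poly_Mapping.keys f. h (Poly_Mapping.lookup f m) * mono_val b m)"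
  by (simp add: poly_eval_def mono_val_def)

lemma sum_of_monomials:
  "f = (\<Sum>m\<in>Poly_Mapping.keys f. Poly_Mapping.single m (Poly_Mapping.lookup f m))"
  by (rule poly_mapping_eqI) (auto simp: lookup_sum lookup_single when_def in_keys_iff)

text \<open>Evaluation is developed along an arbitrary ring homomorphism because it is used twice: along
  the embedding of the ground field into the large complete field, and along \<^const>\<open>Const\<close>, where
  evaluation is the substitution of polynomials for the variables.\<close>

locale coeff_hom =
  fixes h :: "'a::comm_ring_1 \<Rightarrow> 'b::comm_ring_1"
  assumes zero [simp]: "h 0 = 0" and one [simp]: "h 1 = 1"
    and add: "h (x + y) = h x + h y" and mult: "h (x * y) = h x * h y"
begin

lemma poly_eval_superset:
  assumes "finite S" "Poly_Mapping.keys f \<subseteq> S"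
  shows "poly_eval h f b = (\<Sum>m\<in>S. h (Poly_Mapping.lookup f m) * mono_val b m)"
  unfolding poly_eval_eq using assms by (intro sum.mono_neutral_left) (auto simp: in_keys_iff)

lemma poly_eval_single: "poly_eval h (Poly_Mapping.single m a) b = h a * mono_val b m"
  by (subst poly_eval_superset[of "{m}"]) auto

lemma poly_eval_Const: "poly_eval h (Const a) b = h a"
  by (simp add: Const_def poly_eval_single)

lemma poly_eval_Var: "poly_eval h (Var i) b = b i"
  by (simp add: Var_def poly_eval_single mono_val_single)

lemma poly_eval_add: "poly_eval h (f + g) b = poly_eval h f b + poly_eval h g b"
proof -
  let ?S = "Poly_Mapping.keys f \<union> Poly_Mapping.keys g"
  have "Poly_Mapping.keys (f + g) \<subseteq> ?S" by (rule keys_add)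
  then show ?thesis
    by (simp add: poly_eval_superset[of ?S] lookup_add add distrib_right sum.distrib)
qed

lemma poly_eval_sum: "poly_eval h (sum t S) b = (\<Sum>s\<in>S. poly_eval h (t s) b)"
  by (induction S rule: infinite_finite_induct) (simp_all add: poly_eval_add poly_eval_eq[of h 0])

lemma poly_eval_mult: "poly_eval h (f * g) b = poly_eval h f b * poly_eval h g b"
proof -
  let ?t = "\<lambda>f m. Poly_Mapping.single m (Poly_Mapping.lookup f m)"
  have "f * g = (\<Sum>m\<in>Poly_Mapping.keys f. \<Sum>n\<in>Poly_Mapping.keys g. ?t f m * ?t g n)"
    by (subst sum_of_monomials[of f], subst sum_of_monomials[of g], rule sum_product)
  then have "poly_eval h (f * g) b = (\<Sum>m\<in>Poly_Mapping.keys f. \<Sum>n\<in>Poly_Mapping.keys g.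
      (h (Poly_Mapping.lookup f m) * mono_val b m) * (h (Poly_Mapping.lookup g n) * mono_val b n))"
    by (simp add: poly_eval_sum mult_single poly_eval_single mono_val_add mult mult_ac)
  then show ?thesis by (simp add: poly_eval_eq sum_product)
qed

end

lemma Const_add: "Const (a + b) = Const a + Const b"
  by (simp add: Const_def single_add)

lemma Const_mult: "Const (a * b) = Const a * Const b"
  by (simp add: Const_def mult_single)

interpretation Const: coeff_hom "Const :: 'a::comm_ring_1 \<Rightarrow> ('n, 'a) mpoly"
  by standard (simp_all add: Const_add Const_mult, simp_all add: Const_def)

lemma Const_pow: "Const (a ^ k) = (Const a :: ('n, 'a::comm_ring_1) mpoly) ^ k"
  by (induction k) (simp_all add: Const_mult)


section \<open>The height\<close>

lemma (in nonarch_abs) height_ge: "v (Poly_Mapping.lookup f m) \<le> height v f"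
  unfolding height_def by (rule Max_ge) (auto simp: finite_height_set)

lemma (in nonarch_abs) height_attained: obtains m where "v (Poly_Mapping.lookup f m) = height v f"
  using Max_in[OF finite_height_set, of v f] by (auto simp: height_def)

lemma (in nonarch_abs) height_nonneg: "0 \<le> height v f"
  using height_ge[of f 0] nonneg[of "Poly_Mapping.lookup f 0"] by linarith

lemma (in nonarch_abs) height_le:
  assumes "\<And>m. v (Poly_Mapping.lookup f m) \<le> C"
  shows "height v f \<le> C"
  using assms by (metis height_attained)

lemma (in nonarch_abs) height_single: "height v (Poly_Mapping.single m a) = v a"
proof (rule antisym)
  show "height v (Poly_Mapping.single m a) \<le> v a"
    by (rule height_le) (simp add: lookup_single when_def nonneg)
  show "v a \<le> height v (Poly_Mapping.single m a)"
    using height_ge[of "Poly_Mapping.single m a" m] by simp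
qed

lemma (in nonarch_abs) height_add: "height v (f + g) \<le> max (height v f) (height v g)"
proof (rule height_le)
  fix m
  show "v (Poly_Mapping.lookup (f + g) m) \<le> max (height v f) (height v g)"
    using ultra[of "Poly_Mapping.lookup f m" "Poly_Mapping.lookup g m"] height_ge[of f m] height_ge[of g m]
    by (simp add: lookup_add)
qed


section \<open>The Gauss norm\<close>

text \<open>A choice of exponents for the substitution \<open>X\<^sub>i = T ^ e i\<close> under which the given
  monomials stay distinct (Kronecker). With \<open>e i = B ^ \<iota> i\<close> two monomials collide only if
  \<open>B\<close> is a root of the nonzero integer polynomial formed by the differences of their exponents,
  so all but finitely many \<open>B\<close> will do.\<close>

lemma exists_separating_weights:
  fixes S :: "('n::finite \<Rightarrow>\<^sub>0 nat) set"
  assumes "finite S"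
  obtains e :: "'n \<Rightarrow> nat" where "inj_on (\<lambda>m. \<Sum>i\<in>UNIV. e i * Poly_Mapping.lookup m i) S"
proof -
  obtain \<iota> :: "'n \<Rightarrow> nat" where \<iota>: "inj \<iota>"
    using finite_imp_inj_to_nat_seg[of "UNIV :: 'n set"] by auto
  \<comment> \<open>The value of \<open>p m n\<close> at \<open>B\<close> is the difference of the weights of \<open>m\<close> and \<open>n\<close>.\<close>
  define p :: "('n \<Rightarrow>\<^sub>0 nat) \<Rightarrow> ('n \<Rightarrow>\<^sub>0 nat) \<Rightarrow> int poly" where
    "p m n = (\<Sum>i\<in>UNIV. Polynomial.monom (int (Poly_Mapping.lookup m i) - int (Poly_Mapping.lookup n i)) (\<iota> i))"
    for m n
  have nz: "p m n \<noteq> 0" if "m \<noteq> n" for m n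
  proof
    assume "p m n = 0"
    have "Poly_Mapping.lookup m i = Poly_Mapping.lookup n i" for i
    proof -
      have "poly.coeff (p m n) (\<iota> i) =
          (\<Sum>l\<in>UNIV. if l = i then int (Poly_Mapping.lookup m l) - int (Poly_Mapping.lookup n l) else 0)"
        by (simp add: p_def coeff_sum inj_eq[OF \<iota>])
      then show ?thesis using \<open>p m n = 0\<close> by simp
    qed
    then show False using that by (metis poly_mapping_eqI)
  qed
  let ?bad = "\<Union>m\<in>S. \<Union>n\<in>S - {m}. {x. poly (p m n) x = 0}"
  have "finite ?bad" using assms by (auto intro!: poly_roots_finite nz)
  then have "finite (int -` ?bad)" by (intro finite_vimageI) auto
  then obtain B where B: "B \<notin> int -` ?bad" using ex_new_if_finite[OF infinite_UNIV_nat] by blast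
  have "inj_on (\<lambda>m. \<Sum>i\<in>UNIV. B ^ \<iota> i * Poly_Mapping.lookup m i) S"
  proof (rule inj_onI, rule ccontr)
    fix m n assume mn: "m \<in> S" "n \<in> S" "m \<noteq> n"
      and "(\<Sum>i\<in>UNIV. B ^ \<iota> i * Poly_Mapping.lookup m i) = (\<Sum>i\<in>UNIV. B ^ \<iota> i * Poly_Mapping.lookup n i)"
    then have "int (\<Sum>i\<in>UNIV. B ^ \<iota> i * Poly_Mapping.lookup m i) =
        int (\<Sum>i\<in>UNIV. B ^ \<iota> i * Poly_Mapping.lookup n i)" by (simp only:)
    then have "poly (p m n) (int B) = 0"
      by (simp add: p_def poly_sum poly_monom left_diff_distrib right_diff_distrib sum_subtractf mult.commute)
    then show False using B mn by auto
  qed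
  then show ?thesis by (rule that)
qed

text \<open>An equality \<open>a \<rho>\<^sup>k = b \<rho>\<^sup>l\<close> forces \<open>\<rho> ^ (l - k) = a / b\<close>. Since \<open>\<rho> ^ (l - k)\<close> tends to 1 this fails
  eventually when \<open>a / b \<noteq> 1\<close>, and it fails always when \<open>a / b = 1\<close> because \<open>\<rho> < 1\<close>.\<close>

lemma eventually_scaled_powers_differ:
  fixes \<rho> :: "nat \<Rightarrow> real"
  assumes "\<And>n. 0 < \<rho> n" "\<And>n. \<rho> n < 1" "\<rho> \<longlonglongrightarrow> 1" and "0 < a" "0 < b" "k < l"
  shows "eventually (\<lambda>n. a * \<rho> n ^ k \<noteq> b * \<rho> n ^ l) sequentially"
proof -
  have "eventually (\<lambda>n. \<rho> n ^ (l - k) \<noteq> a / b) sequentially"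
  proof (cases "a / b = 1")
    case True
    have "\<rho> n ^ (l - k) < 1" for n
      using assms(1)[of n] assms(2)[of n] assms(6) by (intro power_less_one_iff[THEN iffD2]) auto
    then show ?thesis using True by (simp add: less_imp_neq)
  next
    case False
    moreover have "(\<lambda>n. \<rho> n ^ (l - k)) \<longlonglongrightarrow> 1 ^ (l - k)" by (intro tendsto_intros assms)
    ultimately show ?thesis by (intro tendsto_imp_eventually_ne[of _ 1]) auto
  qed
  then show ?thesis
  proof eventually_elim
    case (elim n)
    have "\<rho> n ^ l = \<rho> n ^ (l - k) * \<rho> n ^ k" using assms(6) by (simp flip: power_add)
    then show ?case using elim assms(1)[of n] assms(5) by (auto simp: field_simps)
  qed
qed

text \<open>Points of the polydisc at which the polynomials of a finite set simultaneously come arbitrarily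
  close to their heights. On the curve \<open>X\<^sub>i = T ^ e i\<close>, with \<open>|T|\<close> below but close enough to 1,
  the nonzero terms of each polynomial have pairwise distinct absolute values, so they cannot cancel,
  while the factor by which the powers of \<open>T\<close> shrink them tends to 1. Treating several polynomials at
  once is what yields the multiplicativity of the height.\<close>

lemma exists_points_approaching_height:
  fixes u :: "'k::field \<Rightarrow> real" and h :: "'a::field \<Rightarrow> 'k" and F :: "('n::finite, 'a) mpoly set"
  assumes u: "nonarch_abs u" and v: "nonarch_abs v" and h: "coeff_hom h" and uh: "\<And>x. u (h x) = v x"
    and \<xi>: "\<And>n. 0 < u (\<xi> n)" "\<And>n. u (\<xi> n) < 1" "(\<lambda>n. u (\<xi> n)) \<longlonglongrightarrow> 1"
    and F: "finite F"
  obtains b :: "nat \<Rightarrow> 'n \<Rightarrow> 'k" where "\<And>n i. u (b n i) \<le> 1"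
    and "\<And>f. f \<in> F \<Longrightarrow> (\<lambda>n. u (poly_eval h f (b n))) \<longlonglongrightarrow> height v f"
proof -
  interpret u: nonarch_abs u by (rule u)
  interpret v: nonarch_abs v by (rule v)
  interpret h: coeff_hom h by (rule h)
  obtain e :: "'n \<Rightarrow> nat"
    where e: "inj_on (\<lambda>m. \<Sum>i\<in>UNIV. e i * Poly_Mapping.lookup m i) (\<Union>f\<in>F. Poly_Mapping.keys f)"
    using F by (metis exists_separating_weights finite_UN finite_keys)
  define k where "k m = (\<Sum>i\<in>UNIV. e i * Poly_Mapping.lookup m i)" for m
  define b where "b n i = \<xi> n ^ e i" for n i
  have val: "mono_val (b n) m = \<xi> n ^ k m" for n m
    by (simp add: mono_val_def b_def k_def power_sum flip: power_mult)
  have b1: "u (b n i) \<le> 1" for n i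
    using \<xi>(1)[of n] \<xi>(2)[of n] by (simp add: b_def u.abs_pow power_le_one)
  have lim: "(\<lambda>n. u (poly_eval h f (b n))) \<longlonglongrightarrow> height v f" if f: "f \<in> F" for f
  proof -
    define t where "t n m = h (Poly_Mapping.lookup f m) * \<xi> n ^ k m" for n m
    have ut: "u (t n m) = v (Poly_Mapping.lookup f m) * u (\<xi> n) ^ k m" for n m
      by (simp add: t_def u.mult u.abs_pow uh)
    have eval: "poly_eval h f (b n) = sum (t n) (Poly_Mapping.keys f)" for n
      by (simp add: poly_eval_eq val t_def)
    have pos: "0 < v (Poly_Mapping.lookup f m)" if "m \<in> Poly_Mapping.keys f" for m
      using that v.nonneg[of "Poly_Mapping.lookup f m"] by (auto simp: in_keys_iff v.eq_0_iff less_le)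
    have upper: "u (poly_eval h f (b n)) \<le> height v f" for n
      unfolding eval
    proof (rule ultrametric_sum_le[where \<nu> = u, OF u.ultra u.zero v.height_nonneg])
      fix m
      have "u (t n m) \<le> v (Poly_Mapping.lookup f m) * 1"
        unfolding ut using \<xi>(1)[of n] \<xi>(2)[of n] v.nonneg by (intro mult_left_mono power_le_one) auto
      then show "u (t n m) \<le> height v f" using v.height_ge[of f m] by linarith
    qed
    obtain m0 where m0: "v (Poly_Mapping.lookup f m0) = height v f" by (rule v.height_attained)
    have "eventually (\<lambda>n. \<forall>m\<in>Poly_Mapping.keys f. \<forall>l\<in>Poly_Mapping.keys f. m \<noteq> l \<longrightarrow> u (t n m) \<noteq> u (t n l)) sequentially"
    proof (intro eventually_ball_finite finite_keys ballI)
      fix m l assume ml: "m \<in> Poly_Mapping.keys f" "l \<in> Poly_Mapping.keys f"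
      show "eventually (\<lambda>n. m \<noteq> l \<longrightarrow> u (t n m) \<noteq> u (t n l)) sequentially"
      proof (cases "m = l")
        case False
        then have "k m \<noteq> k l" using e ml f unfolding k_def inj_on_def by blast
        then consider "k m < k l" | "k l < k m" by linarith
        then show ?thesis
        proof cases
          case 1
          from eventually_scaled_powers_differ[OF \<xi> pos[OF ml(1)] pos[OF ml(2)] this]
          show ?thesis by eventually_elim (simp add: ut)
        next
          case 2
          from eventually_scaled_powers_differ[OF \<xi> pos[OF ml(2)] pos[OF ml(1)] this]
          show ?thesis by eventually_elim (simp add: ut)
        qed
      qed simp
    qed
    then have lower: "eventually (\<lambda>n. height v f * u (\<xi> n) ^ k m0 \<le> u (poly_eval h f (b n))) sequentially"
    proof eventually_elim
      case (elim n)
      show ?case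
      proof (cases "m0 \<in> Poly_Mapping.keys f")
        case True
        have nz: "t n m \<noteq> 0" if "m \<in> Poly_Mapping.keys f" for m
          using pos[OF that] \<xi>(1)[of n] ut[of n m] by (metis less_irrefl mult_pos_pos u.zero zero_less_power)
        have "u (t n m0) \<le> u (sum (t n) (Poly_Mapping.keys f))"
          using elim nz True by (intro u.le_sum_of_distinct_abs) (auto simp: inj_on_def)
        then show ?thesis by (simp add: eval ut m0)
      next
        case False
        then have "height v f = 0" using m0 by (simp add: in_keys_iff)
        then show ?thesis by (simp add: u.nonneg)
      qed
    qed
    have "(\<lambda>n. height v f * u (\<xi> n) ^ k m0) \<longlonglongrightarrow> height v f * 1 ^ k m0"
      by (intro tendsto_intros \<xi>)
    then show ?thesis
      using tendsto_sandwich[OF lower _ _ tendsto_const] upper by simp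
  qed
  show ?thesis by (rule that[of b]) (use b1 lim in auto)
qed

text \<open>Gauss's lemma: at a point where \<open>f\<close>, \<open>g\<close> and \<open>f * g\<close> are all nearly as large as their heights,
  multiplicativity of the absolute value passes to the heights.\<close>

lemma height_mult:
  fixes f g :: "('n::finite, 'a::field) mpoly" and u :: "'k::field \<Rightarrow> real"
  assumes u: "nonarch_abs u" and v: "nonarch_abs v" and h: "coeff_hom h" and uh: "\<And>x. u (h x) = v x"
    and \<xi>: "\<And>n. 0 < u (\<xi> n)" "\<And>n. u (\<xi> n) < 1" "(\<lambda>n. u (\<xi> n)) \<longlonglongrightarrow> 1"
  shows "height v (f * g) = height v f * height v g"
proof -
  obtain b :: "nat \<Rightarrow> 'n \<Rightarrow> 'k"
    where b: "\<And>p. p \<in> {f, g, f * g} \<Longrightarrow> (\<lambda>n. u (poly_eval h p (b n))) \<longlonglongrightarrow> height v p"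
    using exists_points_approaching_height[OF u v h uh \<xi>, of "{f, g, f * g}"]
    by (metis finite.emptyI finite.insertI)
  have "u (poly_eval h (f * g) (b n)) = u (poly_eval h f (b n)) * u (poly_eval h g (b n))" for n
    using coeff_hom.poly_eval_mult[OF h] nonarch_abs.mult[OF u] by metis
  then have "(\<lambda>n. u (poly_eval h (f * g) (b n))) \<longlonglongrightarrow> height v f * height v g"
    using tendsto_mult[OF b[of f] b[of g]] by simp
  then show ?thesis using LIMSEQ_unique b[of "f * g"] by blast
qed

text \<open>The supremum in the Gauss norm is bounded by the height because monomials have absolute value
  at most 1 on the polydisc, and it is approached along the points constructed above.\<close>

lemma gauss_eq_height:
  fixes f :: "('n::finite, 'a::field) mpoly" and u :: "'k::field \<Rightarrow> real"
  assumes u: "nonarch_abs u" and v: "nonarch_abs v" and h: "coeff_hom h" and uh: "\<And>x. u (h x) = v x"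
    and \<xi>: "\<And>n. 0 < u (\<xi> n)" "\<And>n. u (\<xi> n) < 1" "(\<lambda>n. u (\<xi> n)) \<longlonglongrightarrow> 1"
  shows "gauss_aff u h f = height v f"
proof -
  interpret u: nonarch_abs u by (rule u)
  interpret v: nonarch_abs v by (rule v)
  have upper: "u (poly_eval h f b) \<le> height v f" if b: "\<forall>i. u (b i) \<le> 1" for b
    unfolding poly_eval_eq
  proof (rule ultrametric_sum_le[where \<nu> = u, OF u.ultra u.zero v.height_nonneg])
    fix m
    have "u (\<Prod>i\<in>I. b i ^ Poly_Mapping.lookup m i) \<le> 1" for I
    proof (induction I rule: infinite_finite_induct)
      case (insert i I)
      then show ?case using b by (simp add: u.mult u.abs_pow u.nonneg power_le_one mult_le_one)
    qed auto
    then have "u (mono_val b m) \<le> 1" unfolding mono_val_def .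
    then have "v (Poly_Mapping.lookup f m) * u (mono_val b m) \<le> v (Poly_Mapping.lookup f m) * 1"
      using v.nonneg by (intro mult_left_mono) auto
    then show "u (h (Poly_Mapping.lookup f m) * mono_val b m) \<le> height v f"
      using v.height_ge[of f m] by (simp add: u.mult uh)
  qed
  obtain b :: "nat \<Rightarrow> 'n \<Rightarrow> 'k" where b: "\<And>n i. u (b n i) \<le> 1"
    "(\<lambda>n. u (poly_eval h f (b n))) \<longlonglongrightarrow> height v f"
    using exists_points_approaching_height[OF u v h uh \<xi>, of "{f}"] by auto
  show ?thesis
  proof (rule antisym)
    show "gauss_aff u h f \<le> height v f"
      unfolding gauss_aff_def using upper b(1) by (intro cSUP_least) auto
    have "u (poly_eval h f (b n)) \<le> gauss_aff u h f" for n
      unfolding gauss_aff_def using upper b(1) by (intro cSUP_upper bdd_aboveI[of _ "height v f"]) auto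
    then show "height v f \<le> gauss_aff u h f"
      using LIMSEQ_le_const2[OF b(2)] by blast
  qed
qed

text \<open>Roots of a fixed element of absolute value below 1 have absolute value tending to 1 from
  below.\<close>

lemma exists_abs_tending_to_1:
  fixes v :: "'a::field \<Rightarrow> real" and u :: "'k::field \<Rightarrow> real"
  assumes v: "nonarch_abs v" "nontrivial_abs v" and w: "\<And>x. w (to_ac x) = v x"
    and compl: "is_completion w u j"
  obtains \<xi> where "\<And>n::nat. 0 < u (\<xi> n)" "\<And>n. u (\<xi> n) < 1" "(\<lambda>n. u (\<xi> n)) \<longlonglongrightarrow> 1"
proof -
  interpret v: nonarch_abs v by (rule v(1))
  interpret u: nonarch_abs u using compl by (simp add: is_completion_def)
  have j: "j 1 = 1" "j (x * y) = j x * j y" "u (j x) = w x" for x y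
    using compl by (auto simp: is_completion_def)
  have jpow: "j (y ^ n) = j y ^ n" for y n
    by (induction n) (simp_all add: j)
  obtain c where c: "1 < v c" using v.exists_abs_gt_1[OF v(2)] .
  define a where "a = inverse c"
  have a: "0 < v a" "v a < 1" using c by (simp_all add: a_def v.abs_inverse inverse_less_1_iff)
  have "\<exists>y. y ^ Suc n = to_ac a" for n by (rule nth_root_exists) simp
  then obtain y where y: "\<And>n. y n ^ Suc n = to_ac a" by metis
  have "u (j (y n)) ^ Suc n = v a" for n
    by (metis j(3) jpow u.abs_pow w y)
  then have root: "u (j (y n)) = root (Suc n) (v a)" for n
    using u.nonneg by (metis real_root_pos2 zero_less_Suc real_root_power_cancel)
  show ?thesis
  proof
    show "0 < u (j (y n))" "u (j (y n)) < 1" for n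
      unfolding root using a by simp_all
    show "(\<lambda>n. u (j (y n))) \<longlonglongrightarrow> 1"
      unfolding root using LIMSEQ_Suc[OF LIMSEQ_root_const[OF a(1)]] .
  qed
qed


section \<open>Points of affine space\<close>

locale aff_point = nonarch_abs v for v :: "'a::field \<Rightarrow> real" +
  fixes z :: "('n::finite, 'a) seminorm"
  assumes in_aff_space: "z \<in> aff_space v"
begin

lemma at_nonneg: "0 \<le> z f"
  and at_Const: "z (Const a) = v a"
  and at_add: "z (f + g) \<le> max (z f) (z g)"
  and at_mult: "z (f * g) = z f * z g"
  using in_aff_space by (auto simp: aff_space_def)

lemma at_0: "z 0 = 0"
  using at_Const[of 0] by simp

lemma at_1: "z 1 = 1"
  using at_Const[of 1] by simp

lemma at_pow: "z (f ^ k) = z f ^ k"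
  by (induction k) (simp_all add: at_mult at_1)

lemma at_prod: "z (\<Prod>i\<in>I. f i) = (\<Prod>i\<in>I. z (f i))"
  by (induction I rule: infinite_finite_induct) (simp_all add: at_mult at_1)

lemma at_minus: "z (- f) = z f"
proof -
  have "Const (- 1) + 1 = (0 :: ('n, 'a) mpoly)"
    using Const_add[of "- 1 :: 'a" 1] by simp
  then have "Const (- 1) = (- 1 :: ('n, 'a) mpoly)" by (simp add: eq_neg_iff_add_eq_0)
  then have "- f = Const (- 1) * f" by simp
  then show ?thesis by (simp only: at_mult at_Const minus one mult_1)
qed

lemma at_single: "z (Poly_Mapping.single m a) = v a * mono_val (\<lambda>i. z (Var i)) m"
proof -
  have "Poly_Mapping.single m a = Const a * mono_val Var m"
    by (simp add: mono_val_Var Const_def mult_single)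
  then show ?thesis by (simp add: at_mult at_Const mono_val_def at_prod at_pow)
qed

text \<open>The free bound \<open>C\<close> serves two cases: \<open>C = s ^ d\<close> is attained by all monomials of a
  homogeneous polynomial of degree \<open>d\<close>, and for \<open>s \<ge> 1\<close> it dominates the monomials of any polynomial
  of degree \<open>d\<close>.\<close>

lemma at_le:
  assumes s: "0 \<le> s" "\<And>i. z (Var i) \<le> s"
    and C: "0 \<le> C" "\<And>m. m \<in> Poly_Mapping.keys f \<Longrightarrow> s ^ mono_deg m \<le> C"
  shows "z f \<le> height v f * C"
  unfolding sum_of_monomials[of f, THEN arg_cong[where f = z]]
proof (rule ultrametric_sum_le[where \<nu> = z, OF at_add at_0])
  show "0 \<le> height v f * C" by (intro mult_nonneg_nonneg height_nonneg C(1))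
  fix m assume m: "m \<in> Poly_Mapping.keys f"
  have "mono_val (\<lambda>i. z (Var i)) m \<le> mono_val (\<lambda>_. s) m"
    unfolding mono_val_def using s by (intro prod_mono conjI zero_le_power power_mono at_nonneg) auto
  then have "mono_val (\<lambda>i. z (Var i)) m \<le> C"
    using C(2)[OF m] by (simp add: mono_val_const)
  moreover have "0 \<le> mono_val (\<lambda>i. z (Var i)) m"
    unfolding mono_val_def by (intro prod_nonneg) (simp add: at_nonneg)
  ultimately show "z (Poly_Mapping.single m (Poly_Mapping.lookup f m)) \<le> height v f * C"
    unfolding at_single by (intro mult_mono height_ge height_nonneg)
qed

end

lemma pnorm_ge: "z (Var i) \<le> pnorm z"
  unfolding pnorm_def by (rule Max_ge) auto

lemma pnorm_attained: obtains i where "pnorm z = z (Var i)"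
proof -
  have "pnorm z \<in> range (\<lambda>i. z (Var i))" unfolding pnorm_def by (rule Max_in) auto
  then show ?thesis using that by blast
qed

context aff_point
begin

lemma pnorm_nonneg: "0 \<le> pnorm z"
  using pnorm_attained[of z] at_nonneg by metis

lemma at_homogeneous_le:
  assumes "homogeneous f"
  shows "z f \<le> height v f * pnorm z ^ total_deg f"
  using assms unfolding homogeneous_iff by (intro at_le[OF pnorm_nonneg pnorm_ge]) (auto simp: pnorm_nonneg)

lemma at_le_of_pnorm_le:
  assumes "1 \<le> R" "pnorm z \<le> R"
  shows "z f \<le> height v f * R ^ total_deg f"
proof (rule at_le)
  fix m assume "m \<in> Poly_Mapping.keys f"
  then have "mono_deg m \<le> total_deg f" unfolding total_deg_def by (intro Max_ge) auto
  then show "R ^ mono_deg m \<le> R ^ total_deg f" using assms(1) by (intro power_increasing)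
qed (use assms pnorm_ge[of z] in \<open>auto intro: order_trans\<close>)

lemma eq_aff_zero_of_pnorm_0:
  assumes "pnorm z = 0"
  shows "z = aff_zero v"
proof
  fix f :: "('n, 'a) mpoly"
  define a where "a = Poly_Mapping.lookup f 0"
  have var: "z (Var i) = 0" for i
    using pnorm_ge[of z i] at_nonneg[of "Var i"] assms by simp
  have aff_zero: "aff_zero v f = v a"
  proof -
    have "poly_eval (\<lambda>a. a) f (\<lambda>_. 0) = (\<Sum>m\<in>Poly_Mapping.keys f. if m = 0 then a else 0)"
      unfolding poly_eval_eq by (intro sum.cong) (auto simp: mono_val_at_0 a_def)
    also have "\<dots> = a" by (auto simp: a_def in_keys_iff)
    finally show ?thesis by (simp add: aff_zero_def)
  qed
  define r where "r = f - Const a"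
  have "z r \<le> 0"
    unfolding sum_of_monomials[of r, THEN arg_cong[where f = z]]
  proof (rule ultrametric_sum_le[where \<nu> = z, OF at_add at_0])
    fix m assume "m \<in> Poly_Mapping.keys r"
    then have "m \<noteq> 0" by (auto simp: r_def Const_def a_def in_keys_iff lookup_minus)
    then show "z (Poly_Mapping.single m (Poly_Mapping.lookup r m)) \<le> 0"
      by (simp add: at_single var mono_val_at_0)
  qed simp
  then have "z r = 0" using at_nonneg[of r] by linarith
  have "r + Const a = f" "f + - r = Const a" by (simp_all add: r_def)
  then have "z f \<le> max (z r) (v a)" "v a \<le> max (z f) (z r)"
    using at_add[of r "Const a"] at_add[of f "- r"] by (simp_all only: at_Const at_minus)
  then have "z f \<le> v a" "v a \<le> z f"
    using \<open>z r = 0\<close> at_nonneg[of f] nonneg[of a] by simp_all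
  then show "z f = aff_zero v f" using aff_zero by simp
qed

end

text \<open>A seminorm vanishing on all variables sees only the constant coefficient, so the norm is
  positive exactly away from the origin. This is what makes division by \<^const>\<open>pnorm\<close> harmless.\<close>

lemma punctured_iff:
  fixes v :: "'a::field \<Rightarrow> real" and z :: "('n::finite, 'a) seminorm"
  assumes "nonarch_abs v"
  shows "z \<in> punctured v \<longleftrightarrow> z \<in> aff_space v \<and> 0 < pnorm z"
proof -
  interpret nonarch_abs v by (rule assms)
  have "pnorm (aff_zero v :: ('n, 'a) seminorm) = 0"
  proof -
    obtain i :: 'n where "pnorm (aff_zero v :: ('n, 'a) seminorm) = aff_zero v (Var i :: ('n, 'a) mpoly)"
      by (rule pnorm_attained)
    also have "poly_eval (\<lambda>a. a) (Var i :: ('n, 'a) mpoly) (\<lambda>_. 0 :: 'a) = 0"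
      by (intro coeff_hom.poly_eval_Var coeff_hom.intro) auto
    then have "aff_zero v (Var i :: ('n, 'a) mpoly) = 0" by (simp add: aff_zero_def)
    finally show ?thesis .
  qed
  moreover have "0 < pnorm z" if "z \<in> aff_space v" "z \<noteq> aff_zero v"
  proof -
    interpret aff_point v z by unfold_locales (rule that)
    show ?thesis using eq_aff_zero_of_pnorm_0 that(2) pnorm_nonneg by fastforce
  qed
  ultimately show ?thesis unfolding punctured_def by auto
qed


section \<open>Dilations\<close>

text \<open>The substitution \<open>X\<^sub>i \<mapsto> d X\<^sub>i\<close>. Composing a seminorm with it is the action of the scalar \<open>d\<close>
  on affine space.\<close>

definition dilate :: "'a::comm_ring_1 \<Rightarrow> ('n::finite, 'a) mpoly \<Rightarrow> ('n, 'a) mpoly" where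
  "dilate d f = poly_eval Const f (\<lambda>i. Const d * Var i)"

lemma dilate_homogeneous:
  assumes "homogeneous f"
  shows "dilate d f = Const (d ^ total_deg f) * f"
proof -
  have "dilate d f = (\<Sum>m\<in>Poly_Mapping.keys f.
      Const (d ^ total_deg f) * Poly_Mapping.single m (Poly_Mapping.lookup f m))"
    unfolding dilate_def poly_eval_eq
  proof (rule sum.cong[OF refl])
    fix m assume "m \<in> Poly_Mapping.keys f"
    then have "mono_deg m = total_deg f" using assms by (simp add: homogeneous_iff)
    then show "Const (Poly_Mapping.lookup f m) * mono_val (\<lambda>i. Const d * Var i) m =
        Const (d ^ total_deg f) * Poly_Mapping.single m (Poly_Mapping.lookup f m)"
      by (simp add: mono_val_scale mono_val_Var flip: Const_pow) (simp add: Const_def mult_single mult_ac)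
  qed
  then show ?thesis by (simp flip: sum_distrib_left sum_of_monomials)
qed

lemma (in aff_point) dilate_in_aff_space: "(\<lambda>f. z (dilate d f)) \<in> aff_space v"
  by (auto simp: aff_space_def dilate_def Const.poly_eval_add Const.poly_eval_mult
      Const.poly_eval_Const at_nonneg at_Const at_add at_mult)

lemma (in aff_point) pnorm_dilate: "pnorm (\<lambda>f. z (dilate d f)) = v d * pnorm z"
proof -
  have "range (\<lambda>i. z (dilate d (Var i))) = (*) (v d) ` range (\<lambda>i. z (Var i))"
    by (simp add: dilate_homogeneous homogeneous_Var total_deg_Var at_mult at_Const image_image)
  moreover have "mono ((*) (v d))" using nonneg by (intro monoI mult_left_mono)
  ultimately show ?thesis unfolding pnorm_def by (simp add: mono_Max_commute)
qed

lemma proj_dilate: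
  assumes v: "nonarch_abs v" and z: "z \<in> punctured v" and d: "d \<noteq> 0"
  shows "(\<lambda>f. z (dilate d f)) \<in> punctured v" "proj v (\<lambda>f. z (dilate d f)) = proj v z"
proof -
  interpret aff_point v z
    using v z by (auto simp: aff_point_def aff_point_axioms_def punctured_def)
  have vd: "0 < v d" using d nonneg[of d] eq_0_iff[of d] by linarith
  show z': "(\<lambda>f. z (dilate d f)) \<in> punctured v"
    using z vd by (simp add: punctured_iff[OF v] dilate_in_aff_space pnorm_dilate)
  have "z (dilate d f) = v d ^ total_deg f * z f" if "homogeneous f" for f
    by (simp add: dilate_homogeneous[OF that] at_mult at_Const abs_pow)
  then have "((\<lambda>f. z (dilate d f)), z) \<in> proj_rel v"
    unfolding proj_rel_def using z z' vd by auto
  then show "proj v (\<lambda>f. z (dilate d f)) = proj v z"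
    unfolding proj_def by (rule equiv_class_eq[OF equiv_proj_rel])
qed

text \<open>The value group may be discrete, so a positive number cannot in general be scaled to 1 by
  an element of the field, but it can be brought into a fixed compact interval: up to an integer
  power of \<open>c\<close> with \<open>|c| > 1\<close> it lies in \<open>[1, |c|]\<close>.\<close>

lemma (in nonarch_abs) exists_scaling_to_bounded_interval:
  assumes "nontrivial_abs v"
  shows "\<exists>R>1. \<forall>s>0. \<exists>d. d \<noteq> 0 \<and> 1 \<le> v d * s \<and> v d * s \<le> R"
proof -
  obtain c where c1: "1 < v c" using exists_abs_gt_1[OF assms] .
  then have c: "c \<noteq> 0" "1 < v c" by auto
  have "\<exists>d. d \<noteq> 0 \<and> 1 \<le> v d * s \<and> v d * s \<le> v c" if s: "0 < s" for s
  proof -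
    let ?k = "\<lfloor>log (v c) s\<rfloor>"
    have k: "v c powr ?k \<le> s" "s < v c powr (?k + 1)"
      using floor_log_eq_powr_iff[OF s c(2), of ?k] by auto
    have vpow: "v (c powi l) = v c powr l" for l :: int
      using c by (simp add: power_int_def powr_real_of_int abs_pow abs_inverse power_inverse)
    have "v (c powi (- ?k)) * s = s / v c powr ?k"
      by (simp add: vpow powr_minus field_simps)
    moreover have "s / v c powr ?k \<le> v c"
      using k(2) c(2) by (simp add: powr_add field_simps)
    moreover have "1 \<le> s / v c powr ?k" using k(1) c(2) by (simp add: field_simps)
    ultimately show ?thesis using c(1) by (intro exI[of _ "c powi (- ?k)"]) simp
  qed
  then show ?thesis using c(2) by blast
qed


section \<open>Topology of projective space\<close>

lemma continuous_map_aff_eval: "continuous_map (aff_topology v) euclideanreal (\<lambda>z. z f)"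
proof -
  have "openin (aff_topology v) {z \<in> aff_space v. z f \<in> U}" if "open U" for U
    unfolding aff_topology_def using that by (intro topology_generated_by_Basis) blast
  then show ?thesis by (simp add: continuous_map_def)
qed

lemma continuous_map_pnorm:
  fixes v :: "'a::field \<Rightarrow> real"
  shows "continuous_map (aff_topology v :: ('n::finite, 'a) seminorm topology) euclideanreal pnorm"
proof -
  have "continuous_map (aff_topology v) euclideanreal (\<lambda>z :: ('n, 'a) seminorm. Max ((\<lambda>i. z (Var i)) ` I))"
    if "finite I" "I \<noteq> {}" for I
    using that by (induction I rule: finite_ne_induct) (simp_all add: continuous_map_aff_eval continuous_map_real_max)
  from this[of UNIV] show ?thesis by (simp add: pnorm_def[abs_def])
qed

lemma continuous_map_lam:
  fixes v :: "'a::field \<Rightarrow> real" and f :: "('n::finite, 'a) mpoly"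
  assumes v: "nonarch_abs v" and f: "homogeneous f"
  shows "continuous_map (proj_topology v) euclideanreal (lam f)"
proof (rule continuous_compose_quotient_map[OF quotient_map_proj])
  let ?X = "subtopology (aff_topology v) (punctured v) :: ('n, 'a) seminorm topology"
  have "continuous_map ?X euclideanreal (\<lambda>z. z f / pnorm z ^ total_deg f)"
  proof (intro continuous_map_real_divide continuous_map_real_pow continuous_map_from_subtopology
      continuous_map_aff_eval continuous_map_pnorm)
    fix z assume "z \<in> topspace ?X"
    then have "0 < pnorm z" by (simp only: topspace_punctured punctured_iff[OF v])
    then show "pnorm z ^ total_deg f \<noteq> 0" by simp
  qed
  then show "continuous_map ?X euclideanreal (lam f \<circ> proj v)"
  proof (rule continuous_map_eq)
    fix z assume "z \<in> topspace ?X"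
    then have "z \<in> punctured v" by (simp only: topspace_punctured)
    then show "z f / pnorm z ^ total_deg f = (lam f \<circ> proj v) z" using lam_proj[OF f] by simp
  qed
qed

text \<open>A seminorm on the annulus is bounded at each \<open>f\<close> by a constant depending on \<open>f\<close> only, so the
  annulus lies in a product of compact intervals (compact by Tychonoff's theorem), and it is cut out
  there by closed conditions on finitely many coordinates at a time.\<close>

lemma compactin_annulus:
  fixes v :: "'a::field \<Rightarrow> real"
  assumes v: "nonarch_abs v" and R: "1 \<le> R"
  shows "compactin (aff_topology v) {z :: ('n::finite, 'a) seminorm. z \<in> aff_space v \<and> 1 \<le> pnorm z \<and> pnorm z \<le> R}"
    (is "compactin _ ?A")
proof -
  let ?box = "PiE UNIV (\<lambda>f :: ('n, 'a) mpoly. {0..height v f * R ^ total_deg f})"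
  have "compactin (product_topology (\<lambda>_. euclideanreal) UNIV) ?box"
    unfolding compactin_PiE by (intro disjI2) simp
  then have box: "compact ?box" by (simp add: euclidean_product_topology)
  have "?A = aff_space v \<inter> (\<Inter>i. {z. z (Var i) \<le> R}) \<inter> (\<Union>i. {z. 1 \<le> z (Var i)})"
    unfolding pnorm_def by (auto simp: Max_ge_iff)
  moreover have "closed (aff_space v :: ('n, 'a) seminorm set)"
    unfolding aff_space_def
    by (intro closed_Collect_conj closed_Collect_all closed_Collect_le closed_Collect_eq
        continuous_on_max continuous_on_mult continuous_on_product_coordinates continuous_on_const)
  moreover have "closed (\<Inter>i. {z :: ('n, 'a) seminorm. z (Var i) \<le> R})"
    by (intro closed_INT ballI closed_Collect_le continuous_on_product_coordinates continuous_on_const)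
  moreover have "closed (\<Union>i. {z :: ('n, 'a) seminorm. 1 \<le> z (Var i)})"
    by (intro closed_UN finite ballI closed_Collect_le continuous_on_product_coordinates continuous_on_const)
  ultimately have "closed ?A" by (simp add: closed_Int)
  moreover have "?A \<subseteq> ?box"
  proof
    fix z :: "('n, 'a) seminorm" assume z: "z \<in> ?A"
    then interpret aff_point v z using v by (simp add: aff_point_def aff_point_axioms_def)
    show "z \<in> ?box" using z R at_le_of_pnorm_le at_nonneg by (simp add: PiE_UNIV_domain)
  qed
  ultimately have "compact ?A" using closed_Int_compact[OF _ box, of ?A] by (simp add: Int_absorb2)
  then have A: "compactin (subtopology euclidean (aff_space v)) ?A"
    by (auto simp: compactin_subtopology)
  have "continuous_map (subtopology euclidean (aff_space v)) (aff_topology v :: ('n, 'a) seminorm topology) id"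
    unfolding aff_topology_def
  proof (rule continuous_on_generated_topo)
    fix U :: "('n, 'a) seminorm set" assume "U \<in> {{z \<in> aff_space v. z f \<in> V} | f V. open V}"
    then obtain f :: "('n, 'a) mpoly" and V where U: "U = {z \<in> aff_space v. z f \<in> V}" "open V" by blast
    have "open ((\<lambda>z :: ('n, 'a) seminorm. z f) -` V)"
      using U(2) by (intro open_vimage continuous_on_product_coordinates)
    moreover have "id -` U \<inter> topspace (subtopology euclidean (aff_space v)) = ((\<lambda>z. z f) -` V) \<inter> aff_space v"
      by (auto simp: U)
    ultimately show "openin (subtopology euclidean (aff_space v)) (id -` U \<inter> topspace (subtopology euclidean (aff_space v)))"
      unfolding openin_subtopology by auto
  next
    show "id ` topspace (subtopology euclidean (aff_space v)) \<subseteq>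
        \<Union> {{z :: ('n, 'a) seminorm. z \<in> aff_space v \<and> z f \<in> V} | f V. open V}"
      by (auto intro!: exI[of _ UNIV])
  qed
  from image_compactin[OF A this] show ?thesis by simp
qed

text \<open>Dilation by field elements moves every representative into one annulus without changing its
  class, so projective space is the image of a compact set.\<close>

lemma compact_space_proj:
  fixes v :: "'a::field \<Rightarrow> real"
  assumes v: "nonarch_abs v" "nontrivial_abs v"
  shows "compact_space (proj_topology v :: ('n::finite, 'a) seminorm set topology)"
proof -
  interpret nonarch_abs v by (rule v)
  obtain R where R: "1 < R" "\<forall>s>0. \<exists>d. d \<noteq> 0 \<and> 1 \<le> v d * s \<and> v d * s \<le> R"
    using exists_scaling_to_bounded_interval[OF v(2)] by blast
  let ?A = "{z :: ('n, 'a) seminorm. z \<in> aff_space v \<and> 1 \<le> pnorm z \<and> pnorm z \<le> R}"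
  have "?A \<subseteq> punctured v" by (auto simp: punctured_iff[OF v(1)])
  moreover have "compactin (aff_topology v) ?A"
    by (rule compactin_annulus[OF v(1)]) (use R(1) in simp)
  ultimately have "compactin (subtopology (aff_topology v) (punctured v)) ?A"
    by (simp add: compactin_subtopology)
  then have "compactin (proj_topology v) (proj v ` ?A)"
    by (rule image_compactin) (rule quotient_imp_continuous_map[OF quotient_map_proj])
  moreover have "proj v ` ?A = proj_space v"
  proof
    show "proj v ` ?A \<subseteq> proj_space v" using \<open>?A \<subseteq> punctured v\<close> proj_in_space by blast
    show "proj_space v \<subseteq> proj v ` ?A"
    proof
      fix p :: "('n, 'a) seminorm set" assume "p \<in> proj_space v"
      then obtain z where z: "z \<in> punctured v" "p = proj v z"
        by (auto simp: proj_space_def quotient_def proj_def)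
      then have "0 < pnorm z" by (simp add: punctured_iff[OF v(1)])
      then obtain d where d: "d \<noteq> 0" "1 \<le> v d * pnorm z" "v d * pnorm z \<le> R" using R(2) by blast
      interpret aff_point v z
        using z v by (simp add: aff_point_def aff_point_axioms_def punctured_def)
      have "(\<lambda>f. z (dilate d f)) \<in> ?A" using d by (simp add: dilate_in_aff_space pnorm_dilate)
      then show "p \<in> proj v ` ?A"
        by (rule image_eqI[rotated]) (simp only: z(2) proj_dilate(2)[OF v(1) z(1) d(1)])
    qed
  qed
  ultimately show ?thesis by (simp add: compact_space_def)
qed


section \<open>The Gauss point\<close>

lemma lookup_Const_mult: "Poly_Mapping.lookup (Const c * f) m = (c :: 'a::comm_ring_1) * Poly_Mapping.lookup f m"
proof -
  have "Const c * f = Const c * (\<Sum>n\<in>Poly_Mapping.keys f. Poly_Mapping.single n (Poly_Mapping.lookup f n))"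
    by (simp flip: sum_of_monomials)
  also have "\<dots> = (\<Sum>n\<in>Poly_Mapping.keys f. Poly_Mapping.single n (c * Poly_Mapping.lookup f n))"
    by (simp add: Const_def mult_single sum_distrib_left)
  finally have "Poly_Mapping.lookup (Const c * f) m =
      (\<Sum>n\<in>Poly_Mapping.keys f. if n = m then c * Poly_Mapping.lookup f m else 0)"
    by (simp add: lookup_sum lookup_single when_def if_distrib cong: if_cong)
  then show ?thesis by (simp add: in_keys_iff)
qed

lemma height_in_punctured:
  fixes v :: "'a::field \<Rightarrow> real"
  assumes v: "nonarch_abs v"
    and height_mult: "\<And>f g :: ('n::finite, 'a) mpoly. height v (f * g) = height v f * height v g"
  shows "(height v :: ('n, 'a) seminorm) \<in> punctured v" "pnorm (height v :: ('n, 'a) seminorm) = 1"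
proof -
  interpret nonarch_abs v by (rule v)
  show 1: "pnorm (height v :: ('n, 'a) seminorm) = 1"
    by (simp add: pnorm_def Var_def height_single)
  have "(height v :: ('n, 'a) seminorm) \<in> aff_space v"
    by (auto simp: aff_space_def height_nonneg height_mult height_add Const_def height_single)
  then show "(height v :: ('n, 'a) seminorm) \<in> punctured v"
    using 1 by (simp add: punctured_iff[OF v])
qed

text \<open>For every point \<open>z\<close> and homogeneous \<open>f\<close> of degree \<open>d\<close>, the ultrametric inequality bounds \<open>z f\<close>
  by \<open>H(f) \<parallel>z\<parallel>\<^sup>d\<close>, where \<open>H\<close> is the height. If \<open>\<lambda>\<^sub>f \<ge> 1\<close> for all normalized homogeneous \<open>f\<close>, then, after dividing by a coefficient
  of maximal absolute value, equality holds for every homogeneous \<open>f\<close>. This says that \<open>z\<close> is equivalent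
  to the height seminorm, with factor \<open>\<parallel>z\<parallel>\<close>. Hence the functions \<open>\<lambda>\<^sub>f\<close> separate the Gauss point from
  every other point.\<close>

lemma eq_gauss_of_lam_ge_1:
  fixes v :: "'a::field \<Rightarrow> real" and p :: "('n::finite, 'a) seminorm set"
  assumes v: "nonarch_abs v" and gauss: "(height v :: ('n, 'a) seminorm) \<in> punctured v" and p: "p \<in> proj_space v"
    and ge: "\<And>f. homogeneous f \<Longrightarrow> normalized v f \<Longrightarrow> 1 \<le> lam f p"
  shows "p = proj v (height v)"
proof -
  obtain z where z: "z \<in> punctured v" "p = proj v z"
    using p by (auto simp: proj_space_def quotient_def proj_def)
  interpret aff_point v z
    using z v by (simp add: aff_point_def aff_point_axioms_def punctured_def)
  have pos: "0 < pnorm z" using z by (simp add: punctured_iff[OF v])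
  have "z f = pnorm z ^ total_deg f * height v f" if f: "homogeneous f" for f
  proof (rule antisym)
    show "z f \<le> pnorm z ^ total_deg f * height v f"
      using at_homogeneous_le[OF f] by (simp add: mult.commute)
    obtain m where m: "v (Poly_Mapping.lookup f m) = height v f" by (rule height_attained)
    let ?a = "Poly_Mapping.lookup f m"
    show "pnorm z ^ total_deg f * height v f \<le> z f"
    proof (cases "?a = 0")
      case True
      then show ?thesis using m at_nonneg by simp
    next
      case False
      \<comment> \<open>The hypothesis applies to normalized polynomials only.\<close>
      define g where "g = Const (inverse ?a) * f"
      have keys: "Poly_Mapping.keys g = Poly_Mapping.keys f"
        using False by (auto simp: g_def in_keys_iff lookup_Const_mult)
      have va: "v ?a * v (inverse ?a) = 1" using mult[of ?a "inverse ?a"] False by simp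
      have "height v g = v (inverse ?a) * height v f"
      proof (rule antisym)
        show "height v g \<le> v (inverse ?a) * height v f"
          unfolding g_def
          by (rule height_le) (simp only: lookup_Const_mult mult mult_left_mono[OF height_ge nonneg])
        have "v (Poly_Mapping.lookup g m) = v (inverse ?a) * height v f"
          by (simp only: g_def lookup_Const_mult mult m)
        then show "v (inverse ?a) * height v f \<le> height v g"
          using height_ge[of g m] by simp
      qed
      then have "normalized v g" using va m by (simp add: normalized_def mult.commute)
      moreover have g: "homogeneous g" "total_deg g = total_deg f"
        using f by (simp_all add: homogeneous_def total_deg_def keys)
      ultimately have "1 \<le> z g / pnorm z ^ total_deg f"
        using ge[of g] lam_proj[OF g(1) z(1)] z(2) by simp
      then have "pnorm z ^ total_deg f \<le> v (inverse ?a) * z f"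
        using pos by (simp add: g_def at_mult at_Const field_simps)
      then have "v ?a * pnorm z ^ total_deg f \<le> v ?a * (v (inverse ?a) * z f)"
        using nonneg by (rule mult_left_mono)
      also have "v ?a * (v (inverse ?a) * z f) = z f" using va by (simp flip: mult.assoc)
      finally show ?thesis by (simp only: m mult.commute)
    qed
  qed
  then have "(z, height v) \<in> proj_rel v"
    unfolding proj_rel_def using z(1) gauss pos by auto
  then show ?thesis unfolding z(2) proj_def by (rule equiv_class_eq[OF equiv_proj_rel])
qed


section \<open>Equidistribution towards a Dirac measure\<close>

lemma integral_return_borel_of:
  assumes "x \<in> topspace T" "continuous_map T euclideanreal \<phi>"
  shows "(\<integral>z. \<phi> z \<partial>return (borel_of T) x) = \<phi> x"
proof -
  have sub: "{U. openin T U} \<subseteq> Pow (topspace T)" by (auto dest: openin_subset)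
  then have space: "space (borel_of T) = topspace T" by (simp add: borel_of_def)
  have "\<phi> \<in> borel_measurable (borel_of T)"
  proof (rule borel_measurableI)
    fix S :: "real set" assume "open S"
    then have "openin T {x \<in> topspace T. \<phi> x \<in> S}"
      using assms(2) by (intro openin_continuous_map_preimage) auto
    moreover have "\<phi> -` S \<inter> space (borel_of T) = {x \<in> topspace T. \<phi> x \<in> S}" by (auto simp: space)
    ultimately show "\<phi> -` S \<inter> space (borel_of T) \<in> sets (borel_of T)"
      using sub by (simp add: borel_of_def sigma_sets.Basic)
  qed
  then show ?thesis using assms(1) by (intro integral_return) (simp_all add: space)
qed

lemma size_filter_mset_eq_sum: "real (size {#z \<in># M. P z#}) = (\<Sum>z\<in>#M. of_bool (P z))"
  by (induction M) auto

lemma sum_mset_affine_indicators: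
  "(\<Sum>z\<in>#M. a + b * (\<Sum>c\<in>C. of_bool (P c z))) =
    a * real (size M) + b * (\<Sum>c\<in>C. real (size {#z \<in># M. P c z#}))"
  unfolding size_filter_mset_eq_sum
  by (induction M) (simp_all add: sum.distrib algebra_simps)

lemma abs_sum_mset_diff_le:
  "\<bar>(\<Sum>z\<in>#M. \<phi> z) - real (size M) * c\<bar> \<le> (\<Sum>z\<in>#M. \<bar>\<phi> z - c :: real\<bar>)"
proof (induction M)
  case (add x M)
  then show ?case by (simp add: algebra_simps)
qed simp

text \<open>The level \<open>{g < t}\<close> with \<open>t < 1\<close> avoids \<open>x0\<close>. If the averages converge, then testing against a
  continuous function that vanishes at \<open>x0\<close> and is at least 1 on \<open>{g < t}\<close> shows that this level
  carries asymptotically no mass. Conversely, given a continuous \<open>\<phi>\<close>, the closed set where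
  \<open>|\<phi> - \<phi>(x0)| \<ge> \<epsilon>/2\<close> is compact and does not contain \<open>x0\<close>, hence is covered by finitely many such
  levels. The few points in it contribute little because \<open>\<phi>\<close> is bounded, and all the others contribute
  at most \<open>\<epsilon>/2\<close>.\<close>

lemma equidistributed_return_iff:
  fixes T :: "'p topology"
  assumes T: "compact_space T" and x0: "x0 \<in> topspace T"
    and Z: "eventually (\<lambda>\<alpha>. Z \<alpha> \<noteq> {#} \<and> set_mset (Z \<alpha>) \<subseteq> topspace T) F"
    and cont: "\<And>g. g \<in> G \<Longrightarrow> continuous_map T euclideanreal g"
    and g1: "\<And>g. g \<in> G \<Longrightarrow> g x0 = 1"
    and nonneg: "\<And>g x. g \<in> G \<Longrightarrow> x \<in> topspace T \<Longrightarrow> 0 \<le> g x"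
    and sep: "\<And>x. x \<in> topspace T \<Longrightarrow> x \<noteq> x0 \<Longrightarrow> \<exists>g\<in>G. g x < 1"
  shows "equidistributed T (return (borel_of T) x0) F Z \<longleftrightarrow>
    (\<forall>g\<in>G. \<forall>t. 0 < t \<and> t < 1 \<longrightarrow>
      ((\<lambda>\<alpha>. real (size {#z \<in># Z \<alpha>. g z < t#}) / real (size (Z \<alpha>))) \<longlongrightarrow> 0) F)"
    (is "?equi \<longleftrightarrow> ?frac")
proof
  assume equi: ?equi
  show ?frac
  proof (intro ballI allI impI)
    fix g and t :: real assume g: "g \<in> G" and t: "0 < t \<and> t < 1"
    \<comment> \<open>This vanishes where \<open>g \<ge> 1\<close>, in particular at \<open>x0\<close>, and exceeds 1 where \<open>g < t\<close>.\<close>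
    define \<phi> where "\<phi> x = max 0 ((1 - g x) / (1 - t))" for x
    have \<phi>: "continuous_map T euclideanreal \<phi>"
      unfolding \<phi>_def using t
      by (intro continuous_map_real_max continuous_map_real_divide continuous_map_diff cont[OF g]) auto
    have "\<phi> x0 = 0" using g1[OF g] by (simp add: \<phi>_def)
    then have "(\<integral>z. \<phi> z \<partial>return (borel_of T) x0) = 0"
      using integral_return_borel_of[OF x0 \<phi>] by simp
    moreover have "((\<lambda>\<alpha>. (\<Sum>z\<in>#Z \<alpha>. \<phi> z) / real (size (Z \<alpha>)))
        \<longlongrightarrow> (\<integral>z. \<phi> z \<partial>return (borel_of T) x0)) F"
      using equi \<phi> unfolding equidistributed_def by blast
    ultimately have lim: "((\<lambda>\<alpha>. (\<Sum>z\<in>#Z \<alpha>. \<phi> z) / real (size (Z \<alpha>))) \<longlongrightarrow> 0) F"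
      by (simp only:)
    have "real (size {#z \<in># Z \<alpha>. g z < t#}) / real (size (Z \<alpha>)) \<le> (\<Sum>z\<in>#Z \<alpha>. \<phi> z) / real (size (Z \<alpha>))" for \<alpha>
    proof -
      have "of_bool (g z < t) \<le> \<phi> z" for z
        using t by (auto simp: \<phi>_def le_max_iff_disj field_simps)
      then have "real (size {#z \<in># Z \<alpha>. g z < t#}) \<le> (\<Sum>z\<in>#Z \<alpha>. \<phi> z)"
        unfolding size_filter_mset_eq_sum by (intro sum_mset_mono)
      then show ?thesis by (intro divide_right_mono) auto
    qed
    then show "((\<lambda>\<alpha>. real (size {#z \<in># Z \<alpha>. g z < t#}) / real (size (Z \<alpha>))) \<longlongrightarrow> 0) F"
      by (intro tendsto_sandwich[OF _ _ tendsto_const lim] always_eventually allI) auto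
  qed
next
  assume frac: ?frac
  show ?equi
    unfolding equidistributed_def
  proof (intro allI impI)
    fix \<phi> assume \<phi>: "continuous_map T euclideanreal \<phi>"
    define \<psi> where "\<psi> x = \<bar>\<phi> x - \<phi> x0\<bar>" for x
    have \<psi>: "continuous_map T euclideanreal \<psi>"
      unfolding \<psi>_def by (intro continuous_map_real_abs continuous_map_diff \<phi>) auto
    have "compact (\<psi> ` topspace T)"
      using image_compactin[OF _ \<psi>, of "topspace T"] T by (simp add: compact_space_def)
    then obtain B where B: "0 < B" "\<And>x. x \<in> topspace T \<Longrightarrow> \<psi> x \<le> B"
      using compact_imp_bounded by (force simp: bounded_pos)
    have "((\<lambda>\<alpha>. (\<Sum>z\<in>#Z \<alpha>. \<phi> z) / real (size (Z \<alpha>))) \<longlongrightarrow> \<phi> x0) F"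
    proof (rule tendstoI)
      fix \<epsilon> :: real assume \<epsilon>: "0 < \<epsilon>"
      let ?W = "{x \<in> topspace T. \<psi> x \<in> {\<epsilon> / 2..}}"
      have "compactin T ?W"
        using T \<psi> by (intro closedin_compact_space closedin_continuous_map_preimage) auto
      moreover let ?U = "\<lambda>(g, t). {x \<in> topspace T. g x \<in> {..<t}}"
      have "\<And>U. U \<in> ?U ` (G \<times> {0<..<1}) \<Longrightarrow> openin T U"
        by (auto intro!: openin_continuous_map_preimage[OF cont, of _ "{..<_}", simplified])
      moreover have "?W \<subseteq> \<Union> (?U ` (G \<times> {0<..<1}))"
      proof
        fix x assume x: "x \<in> ?W"
        then have "x \<noteq> x0" using \<epsilon> by (auto simp: \<psi>_def)
        then obtain g where g: "g \<in> G" "g x < 1" using sep x by blast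
        then have "0 \<le> g x" using nonneg x by blast
        then have "x \<in> ?U (g, (1 + g x) / 2)" "(g, (1 + g x) / 2) \<in> G \<times> {0<..<1}"
          using g x by auto
        then show "x \<in> \<Union> (?U ` (G \<times> {0<..<1}))" by blast
      qed
      ultimately obtain \<F> where \<F>: "finite \<F>" "\<F> \<subseteq> ?U ` (G \<times> {0<..<1})" "?W \<subseteq> \<Union> \<F>"
        using compactinD[of T ?W "?U ` (G \<times> {0<..<1})"] by blast
      obtain C where C: "finite C" "C \<subseteq> G \<times> {0<..<1}" "\<F> = ?U ` C"
        using finite_subset_image[OF \<F>(1,2)] by blast
      have bound: "\<psi> x \<le> \<epsilon> / 2 + B * (\<Sum>c\<in>C. of_bool (fst c x < snd c))" if x: "x \<in> topspace T" for x
      proof (cases "x \<in> ?W")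
        case True
        then obtain c where c: "c \<in> C" "x \<in> ?U c" using \<F>(3) C(3) by blast
        then have "(1::real) \<le> (\<Sum>c\<in>C. of_bool (fst c x < snd c))"
          using C(1) by (intro order_trans[OF _ member_le_sum[of c]]) (auto simp: case_prod_unfold)
        then have "B * 1 \<le> B * (\<Sum>c\<in>C. of_bool (fst c x < snd c))"
          using B(1) by (intro mult_left_mono) auto
        then show ?thesis using B(2)[OF x] \<epsilon> by simp
      next
        case False
        have "0 \<le> B * (\<Sum>c\<in>C. of_bool (fst c x < snd c))" using B(1) by (simp add: sum_nonneg)
        then show ?thesis using False x by simp
      qed
      let ?r = "\<lambda>\<alpha>. B * (\<Sum>c\<in>C. real (size {#z \<in># Z \<alpha>. fst c z < snd c#}) / real (size (Z \<alpha>)))"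
      have "(?r \<longlongrightarrow> B * (\<Sum>c\<in>C. 0)) F"
        using frac C(2) by (intro tendsto_mult tendsto_const tendsto_sum) auto
      then have "eventually (\<lambda>\<alpha>. ?r \<alpha> < \<epsilon> / 2) F"
        using \<epsilon> by (intro order_tendstoD(2)) auto
      with Z show "eventually (\<lambda>\<alpha>. dist ((\<Sum>z\<in>#Z \<alpha>. \<phi> z) / real (size (Z \<alpha>))) (\<phi> x0) < \<epsilon>) F"
      proof eventually_elim
        case (elim \<alpha>)
        let ?n = "real (size (Z \<alpha>))"
        have n: "0 < ?n" using elim by (simp add: nonempty_has_size)
        have "(\<Sum>z\<in>#Z \<alpha>. \<psi> z) \<le> (\<Sum>z\<in>#Z \<alpha>. \<epsilon> / 2 + B * (\<Sum>c\<in>C. of_bool (fst c z < snd c)))"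
          using elim by (intro sum_mset_mono bound) auto
        then have "(\<Sum>z\<in>#Z \<alpha>. \<psi> z) / ?n \<le> \<epsilon> / 2 + ?r \<alpha>"
          using n unfolding sum_mset_affine_indicators
          by (simp add: field_simps flip: sum_divide_distrib)
        moreover have "\<bar>(\<Sum>z\<in>#Z \<alpha>. \<phi> z) - ?n * \<phi> x0\<bar> / ?n \<le> (\<Sum>z\<in>#Z \<alpha>. \<psi> z) / ?n"
          unfolding \<psi>_def by (intro divide_right_mono abs_sum_mset_diff_le) auto
        moreover have "(\<Sum>z\<in>#Z \<alpha>. \<phi> z) / ?n - \<phi> x0 = ((\<Sum>z\<in>#Z \<alpha>. \<phi> z) - ?n * \<phi> x0) / ?n"
          using n by (auto simp: diff_divide_distrib)
        ultimately show ?case using elim n by (simp add: dist_real_def abs_divide)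
      qed
    qed
    then show "((\<lambda>\<alpha>. (\<Sum>z\<in>#Z \<alpha>. \<phi> z) / real (size (Z \<alpha>))) \<longlongrightarrow> (\<integral>z. \<phi> z \<partial>return (borel_of T) x0)) F"
      by (simp add: integral_return_borel_of[OF x0 \<phi>])
  qed
qed

theorem theorem8:
  fixes v :: "'a::field \<Rightarrow> real"
    and w :: "'a alg_closure \<Rightarrow> real"
    and u :: "'k::field \<Rightarrow> real"
    and j :: "'a alg_closure \<Rightarrow> 'k"
    and N :: nat
    and A :: "'i set" and r :: "'i \<Rightarrow> 'i \<Rightarrow> bool"
    and Z :: "'i \<Rightarrow> ('n::finite, 'a) seminorm set multiset"
    and \<gamma> :: "('n, 'a) seminorm set"
  assumes K: "nonarch_abs v" "nontrivial_abs v" "complete_abs v"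
    and ext: "nonarch_abs w" "\<And>x. w (to_ac x) = v x"
    and compl: "is_completion w u j"
    and N: "N \<ge> 1" "CARD('n) = N + 1"
    and net: "directed_set A r"
    and Z: "\<And>\<alpha>. \<alpha> \<in> A \<Longrightarrow> Z \<alpha> \<noteq> {#}" "\<And>\<alpha>. \<alpha> \<in> A \<Longrightarrow> set_mset (Z \<alpha>) \<subseteq> proj_space v"
  defines "\<gamma> \<equiv> proj v (gauss_aff u (j \<circ> to_ac))"
  shows "equidistributed (proj_topology v) (return (borel_of (proj_topology v)) \<gamma>) (net_filter A r) Z
    \<longleftrightarrow> (\<forall>f t. homogeneous f \<and> normalized v f \<and> 0 < t \<and> t < 1 \<longrightarrow>
      ((\<lambda>\<alpha>. real (size {#z \<in># Z \<alpha>. lam f z < t#}) / real (size (Z \<alpha>))) \<longlongrightarrow> 0) (net_filter A r))"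
proof -
  have u: "nonarch_abs u" and h: "coeff_hom (j \<circ> to_ac)"
    using compl by (auto simp: is_completion_def coeff_hom_def)
  have uh: "u ((j \<circ> to_ac) x) = v x" for x
    using compl ext(2) by (simp add: is_completion_def)
  obtain \<xi> where \<xi>: "\<And>n::nat. 0 < u (\<xi> n)" "\<And>n. u (\<xi> n) < 1" "(\<lambda>n. u (\<xi> n)) \<longlonglongrightarrow> 1"
    by (rule exists_abs_tending_to_1[OF K(1,2) ext(2) compl]) blast
  \<comment> \<open>This equality holds on all polynomials, so it places the Gauss point in affine space.\<close>
  have gauss: "(gauss_aff u (j \<circ> to_ac) :: ('n, 'a) seminorm) = height v"
    by (rule HOL.ext) (rule gauss_eq_height[OF u K(1) h uh \<xi>])
  have ht: "(height v :: ('n, 'a) seminorm) \<in> punctured v" "pnorm (height v :: ('n, 'a) seminorm) = 1"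
    using height_in_punctured[OF K(1)] height_mult[OF u K(1) h uh \<xi>] by blast+
  have \<gamma>: "\<gamma> = proj v (height v)" by (simp add: \<gamma>_def gauss)
  let ?G = "{lam f | f :: ('n, 'a) mpoly. homogeneous f \<and> normalized v f}"
  have "equidistributed (proj_topology v) (return (borel_of (proj_topology v)) \<gamma>) (net_filter A r) Z \<longleftrightarrow>
    (\<forall>g\<in>?G. \<forall>t. 0 < t \<and> t < 1 \<longrightarrow>
      ((\<lambda>\<alpha>. real (size {#z \<in># Z \<alpha>. g z < t#}) / real (size (Z \<alpha>))) \<longlongrightarrow> 0) (net_filter A r))"
  proof (rule equidistributed_return_iff)
    show "compact_space (proj_topology v :: ('n, 'a) seminorm set topology)"
      by (rule compact_space_proj[OF K(1,2)])
    show "\<gamma> \<in> topspace (proj_topology v)"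
      by (simp add: \<gamma> proj_in_space ht)
    show "eventually (\<lambda>\<alpha>. Z \<alpha> \<noteq> {#} \<and> set_mset (Z \<alpha>) \<subseteq> topspace (proj_topology v)) (net_filter A r)"
      using Z net by (auto simp: eventually_net_filter[OF net] directed_set_def)
  next
    fix g assume "g \<in> ?G"
    then obtain f :: "('n, 'a) mpoly" where f: "g = lam f" "homogeneous f" "normalized v f" by blast
    show "continuous_map (proj_topology v) euclideanreal g"
      unfolding f(1) by (rule continuous_map_lam[OF K(1) f(2)])
    show "g \<gamma> = 1"
      using f(3) by (simp add: f(1) \<gamma> lam_proj[OF f(2) ht(1)] ht(2) normalized_def)
    fix x :: "('n, 'a) seminorm set" assume "x \<in> topspace (proj_topology v)"
    then obtain z where z: "z \<in> punctured v" "x = proj v z"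
      by (auto simp: proj_space_def quotient_def proj_def)
    interpret aff_point v z
      using z K(1) by (simp add: aff_point_def aff_point_axioms_def punctured_def)
    show "0 \<le> g x"
      by (simp add: f(1) z(2) lam_proj[OF f(2) z(1)] at_nonneg pnorm_nonneg)
  next
    fix x :: "('n, 'a) seminorm set" assume "x \<in> topspace (proj_topology v)" "x \<noteq> \<gamma>"
    then show "\<exists>g\<in>?G. g x < 1"
      using eq_gauss_of_lam_ge_1[OF K(1) ht(1), of x] by (fastforce simp: \<gamma>)
  qed
  then show ?thesis by blast
qed

end
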